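(* Let $G_1,\dots,G_n$ be finitely generated groups with a common subgroup $C$ such that each $G_i$ admits a regular positive cone relative to $C$ and $C$ admits a regular positive cone. Let $G$ be the free product of the $G_i$ amalgamated over $C$. Then $G\times\mathbb{Z}$ admits a regular left-order.
   Context: For a group $H$ and subgroup $K$, a positive cone relative to $K$ is a subsemigroup $P\subseteq H$ with $H=P\sqcup K\sqcup P^{-1}$ (disjoint); a positive cone is a positive cone relative to the trivial subgroup. Such a (relative) positive cone of a finitely generated group $H$ is regular if there are a finite set $X$, a surjective monoid homomorphism $\pi\colon X^*\to H$ and a regular language $\mathcal{L}\subseteq X^*$ (accepted by a finite state automaton) with $\pi(\mathcal{L})=P$. A left-order is regular if its positive cone $\{g:1\prec g\}$ is regular. *)

theory Defs
  imports "HOL-Algebra.Algebra"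
begin

definition rel_pos_cone :: "('a, 'b) monoid_scheme \<Rightarrow> 'a set \<Rightarrow> 'a set \<Rightarrow> bool" where
  "rel_pos_cone H K P \<longleftrightarrow>
     P \<subseteq> carrier H \<and>
     (\<forall>x\<in>P. \<forall>y\<in>P. x \<otimes>\<^bsub>H\<^esub> y \<in> P) \<and>
     carrier H = P \<union> K \<union> (m_inv H) ` P \<and>
     P \<inter> K = {} \<and> P \<inter> (m_inv H) ` P = {} \<and> K \<inter> (m_inv H) ` P = {}"

definition pos_cone :: "('a, 'b) monoid_scheme \<Rightarrow> 'a set \<Rightarrow> bool" where
  "pos_cone H P \<longleftrightarrow> rel_pos_cone H {\<one>\<^bsub>H\<^esub>} P"

definition regular_lang :: "nat set \<Rightarrow> nat list set \<Rightarrow> bool" where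
  "regular_lang Alph L \<longleftrightarrow>
     (\<exists>(St::nat set) (s0::nat) (tr::nat \<Rightarrow> nat \<Rightarrow> nat) (Fin::nat set).
        finite St \<and> s0 \<in> St \<and> (\<forall>q\<in>St. \<forall>x\<in>Alph. tr q x \<in> St) \<and> Fin \<subseteq> St \<and>
        L = {w \<in> lists Alph. foldl tr s0 w \<in> Fin})"

definition word_hom :: "nat set \<Rightarrow> ('a, 'b) monoid_scheme \<Rightarrow> (nat list \<Rightarrow> 'a) \<Rightarrow> bool" where
  "word_hom Alph H \<pi> \<longleftrightarrow>
     (\<forall>w\<in>lists Alph. \<pi> w \<in> carrier H) \<and> \<pi> [] = \<one>\<^bsub>H\<^esub> \<and>
     (\<forall>u\<in>lists Alph. \<forall>v\<in>lists Alph. \<pi> (u @ v) = \<pi> u \<otimes>\<^bsub>H\<^esub> \<pi> v)"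

definition regular_set :: "('a, 'b) monoid_scheme \<Rightarrow> 'a set \<Rightarrow> bool" where
  "regular_set H P \<longleftrightarrow>
     (\<exists>(Alph::nat set) \<pi> L. finite Alph \<and> word_hom Alph H \<pi> \<and> \<pi> ` lists Alph = carrier H \<and>
        L \<subseteq> lists Alph \<and> regular_lang Alph L \<and> \<pi> ` L = P)"

definition regular_rel_pos_cone :: "('a, 'b) monoid_scheme \<Rightarrow> 'a set \<Rightarrow> 'a set \<Rightarrow> bool" where
  "regular_rel_pos_cone H K P \<longleftrightarrow> rel_pos_cone H K P \<and> regular_set H P"

definition regular_pos_cone :: "('a, 'b) monoid_scheme \<Rightarrow> 'a set \<Rightarrow> bool" where
  "regular_pos_cone H P \<longleftrightarrow> pos_cone H P \<and> regular_set H P"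

definition left_order :: "('a, 'b) monoid_scheme \<Rightarrow> ('a \<Rightarrow> 'a \<Rightarrow> bool) \<Rightarrow> bool" where
  "left_order H R \<longleftrightarrow>
     (\<forall>a\<in>carrier H. \<not> R a a) \<and>
     (\<forall>a\<in>carrier H. \<forall>b\<in>carrier H. \<forall>c\<in>carrier H. R a b \<longrightarrow> R b c \<longrightarrow> R a c) \<and>
     (\<forall>a\<in>carrier H. \<forall>b\<in>carrier H. a = b \<or> R a b \<or> R b a) \<and>
     (\<forall>g\<in>carrier H. \<forall>a\<in>carrier H. \<forall>b\<in>carrier H. R a b \<longrightarrow> R (g \<otimes>\<^bsub>H\<^esub> a) (g \<otimes>\<^bsub>H\<^esub> b))"

definition regular_left_order :: "('a, 'b) monoid_scheme \<Rightarrow> ('a \<Rightarrow> 'a \<Rightarrow> bool) \<Rightarrow> bool" where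
  "regular_left_order H R \<longleftrightarrow>
     left_order H R \<and> regular_set H {g \<in> carrier H. R \<one>\<^bsub>H\<^esub> g}"

definition fin_gen_group :: "('a, 'b) monoid_scheme \<Rightarrow> bool" where
  "fin_gen_group H \<longleftrightarrow> group H \<and>
     (\<exists>S. finite S \<and> S \<subseteq> carrier H \<and> generate H S = carrier H)"

text \<open>Groups G i (i = 1..n), a group C and injective homomorphisms \<iota> i : C \<rightarrow> G i.
  The amalgamated free product is presented as the monoid of words over the disjoint union
  of the G i modulo the congruence generated by the multiplication tables of the factors,
  identification of the units with the empty word, and identification of the copies of C.\<close>

definition amal_letters :: "nat \<Rightarrow> (nat \<Rightarrow> ('a, 'b) monoid_scheme) \<Rightarrow> (nat \<times> 'a) set" where
  "amal_letters n G = {(i, g). i \<in> {1..n} \<and> g \<in> carrier (G i)}"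

inductive amal_eq ::
  "nat \<Rightarrow> (nat \<Rightarrow> ('a, 'b) monoid_scheme) \<Rightarrow> ('c, 'd) monoid_scheme \<Rightarrow> (nat \<Rightarrow> 'c \<Rightarrow> 'a)
    \<Rightarrow> (nat \<times> 'a) list \<Rightarrow> (nat \<times> 'a) list \<Rightarrow> bool"
  for n G C \<iota> where
  refl: "w \<in> lists (amal_letters n G) \<Longrightarrow> amal_eq n G C \<iota> w w"
| sym: "amal_eq n G C \<iota> u v \<Longrightarrow> amal_eq n G C \<iota> v u"
| trans: "amal_eq n G C \<iota> u v \<Longrightarrow> amal_eq n G C \<iota> v w \<Longrightarrow> amal_eq n G C \<iota> u w"
| ctx: "amal_eq n G C \<iota> u v \<Longrightarrow> a \<in> lists (amal_letters n G) \<Longrightarrow> b \<in> lists (amal_letters n G)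
        \<Longrightarrow> amal_eq n G C \<iota> (a @ u @ b) (a @ v @ b)"
| mult: "i \<in> {1..n} \<Longrightarrow> g \<in> carrier (G i) \<Longrightarrow> h \<in> carrier (G i)
        \<Longrightarrow> amal_eq n G C \<iota> [(i, g), (i, h)] [(i, g \<otimes>\<^bsub>G i\<^esub> h)]"
| one: "i \<in> {1..n} \<Longrightarrow> amal_eq n G C \<iota> [(i, \<one>\<^bsub>G i\<^esub>)] []"
| amal: "i \<in> {1..n} \<Longrightarrow> j \<in> {1..n} \<Longrightarrow> c \<in> carrier C
        \<Longrightarrow> amal_eq n G C \<iota> [(i, \<iota> i c)] [(j, \<iota> j c)]"

definition amal_class ::
  "nat \<Rightarrow> (nat \<Rightarrow> ('a, 'b) monoid_scheme) \<Rightarrow> ('c, 'd) monoid_scheme \<Rightarrow> (nat \<Rightarrow> 'c \<Rightarrow> 'a)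
    \<Rightarrow> (nat \<times> 'a) list \<Rightarrow> (nat \<times> 'a) list set" where
  "amal_class n G C \<iota> w = {v. amal_eq n G C \<iota> w v}"

definition amalgamated_product ::
  "nat \<Rightarrow> (nat \<Rightarrow> ('a, 'b) monoid_scheme) \<Rightarrow> ('c, 'd) monoid_scheme \<Rightarrow> (nat \<Rightarrow> 'c \<Rightarrow> 'a)
    \<Rightarrow> ((nat \<times> 'a) list set) monoid" where
  "amalgamated_product n G C \<iota> =
     \<lparr>carrier = amal_class n G C \<iota> ` lists (amal_letters n G),
      monoid.mult = (\<lambda>Alph Y. {w. \<exists>x\<in>Alph. \<exists>y\<in>Y. amal_eq n G C \<iota> (x @ y) w}),
      one = amal_class n G C \<iota> []\<rparr>"

end

theory Submission
  imports Defs "HOL-Library.Countable"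
begin

text \<open>Write \<open>g\<close> in the amalgam as an alternating product of factor elements outside \<open>C\<close>.
  Following Dicks and Sunic, let \<open>\<tau> g\<close> be the number of positive minus the number of negative
  syllables, plus the number of ascents minus the number of descents in the sequence of factor
  indices, and let \<open>\<tau> = 0\<close> on \<open>C\<close>. Outside \<open>C\<close> the values are odd, inversion changes the sign, and
  \<open>\<tau> (g h) \<ge> \<tau> g + \<tau> h - 1\<close>; so \<open>{(g, m). \<tau> g + 2 m \<ge> 1} \<union> P\<^sub>C \<times> {0}\<close> is a positive cone of the
  product with the integers. It is regular because the central coordinate compensates \<open>\<tau>\<close>
  syllable by syllable, so that a finite automaton need only remember the index of the last
  syllable. That \<open>\<tau>\<close> is well defined is never needed: \<open>\<tau>\<close> is replaced by the relation
  ``\<open>g\<close> has an alternating expression of weight \<open>t\<close>'', and the normal form theorem enters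
  only through the nontriviality of alternating products.\<close>

section \<open>Rational subsets of monoids\<close>

text \<open>The slice \<open>m = 0\<close> of the cone already orders the amalgam. Membership there
  asks for the sign of an unbounded sum, which an automaton reading syllables would have to count;
  the integer factor stores this count in the group element instead. The jumps are present for
  parity: \<open>n\<close> syllables give \<open>n\<close> signs and \<open>n - 1\<close> jumps, an
  odd number of summands 1 or -1, so the weight of an alternating product cannot vanish. The factor
  2 in \<open>t + 2 * m\<close> preserves this parity, and the value zero is left for
  \<open>H\<close> times zero only, where \<open>P\<close> decides. A relation can replace the
  weight function because closure under products and totality ask only that some weight be large; a
  spurious weight could do harm only at the unit, and there nontriviality of alternating products
  excludes it. Regularity is treated through rational subsets, which compose without any choice of
  alphabets; finite generation travels along as rationality of the whole group.\<close>

inductive walk :: "('a, 'b) monoid_scheme \<Rightarrow> ('q \<times> 'a \<times> 'q) set \<Rightarrow> 'q \<Rightarrow> 'a \<Rightarrow> 'q \<Rightarrow> bool"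
  for M E where
  Nil: "walk M E p \<one>\<^bsub>M\<^esub> p"
| Cons: "(p, a, q) \<in> E \<Longrightarrow> walk M E q g r \<Longrightarrow> walk M E p (a \<otimes>\<^bsub>M\<^esub> g) r"

text \<open>The edge set may be infinite here, so that graphs whose edges carry all elements of a
  rational set make sense as well. Finiteness is imposed only in \<open>rational\<close>.\<close>

definition walks :: "('a, 'b) monoid_scheme \<Rightarrow> ('q \<times> 'a \<times> 'q) set \<Rightarrow> 'q set \<Rightarrow> 'q set \<Rightarrow> 'a set" where
  "walks M E I F = {g. \<exists>p\<in>I. \<exists>q\<in>F. walk M E p g q}"

text \<open>The states are naturals so that the graph can be quantified existentially at a fixed
  type; \<open>rational_walks\<close> then admits every countable type of states.\<close>

definition rational :: "('a, 'b) monoid_scheme \<Rightarrow> 'a set \<Rightarrow> bool" where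
  "rational M S \<longleftrightarrow>
     (\<exists>(E :: (nat \<times> 'a \<times> nat) set) I F. finite E \<and> finite I \<and> finite F \<and>
        E \<subseteq> UNIV \<times> carrier M \<times> UNIV \<and> S = walks M E I F)"

lemma walk_carrier:
  assumes "monoid M" "E \<subseteq> UNIV \<times> carrier M \<times> UNIV" "walk M E p g q"
  shows "g \<in> carrier M"
proof -
  interpret monoid M by fact
  show ?thesis using assms(3) by induction (use assms(2) in auto)
qed

lemma walks_subset_carrier:
  assumes "monoid M" "E \<subseteq> UNIV \<times> carrier M \<times> UNIV"
  shows "walks M E I F \<subseteq> carrier M"
  unfolding walks_def by (auto dest: walk_carrier[OF assms])

lemma rational_subset_carrier: "monoid M \<Longrightarrow> rational M S \<Longrightarrow> S \<subseteq> carrier M"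
  unfolding rational_def by (elim exE conjE) (simp add: walks_subset_carrier)

lemma walk_trans:
  assumes "monoid M" "E \<subseteq> UNIV \<times> carrier M \<times> UNIV" "walk M E p g q" "walk M E q h r"
  shows "walk M E p (g \<otimes>\<^bsub>M\<^esub> h) r"
proof -
  interpret monoid M by fact
  show ?thesis using assms(3,4)
  proof induction
    case (Nil p)
    then show ?case using walk_carrier[OF assms(1,2) Nil] by simp
  next
    case (Cons p a q g r)
    then have "a \<in> carrier M" "g \<in> carrier M" "h \<in> carrier M"
      using assms(2) walk_carrier[OF assms(1,2)] by blast+
    with Cons show ?case by (metis m_assoc walk.Cons)
  qed
qed

lemma walk_single:
  assumes "monoid M" "(p, a, q) \<in> E" "a \<in> carrier M"
  shows "walk M E p a q"
  using walk.Cons[OF assms(2) walk.Nil, where M = M] assms(1,3) by (simp add: monoid.r_one)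

lemma walk_mono: "walk M E p g q \<Longrightarrow> E \<subseteq> E' \<Longrightarrow> walk M E' p g q"
  by (induction rule: walk.induct) (blast intro: walk.intros)+

lemma walk_rename:
  "walk M E p g q \<Longrightarrow> walk M ((\<lambda>(p, a, q). (f p, a, f q)) ` E) (f p) g (f q)"
proof (induction rule: walk.induct)
  case (Cons p a q g r)
  then have "(f p, a, f q) \<in> (\<lambda>(p, a, q). (f p, a, f q)) ` E" by force
  then show ?case using Cons(3) by (rule walk.Cons)
qed (rule walk.Nil)

text \<open>Both directions proceed edge by edge, and no injectivity is involved because a walk in
  the relabelled graph lifts along any choice of preimages of its edges. Between monoids a
  multiplicative map need not fix the unit, hence the separate assumption on it.\<close>

lemma walk_relabel:
  assumes "\<phi> \<in> hom M N" "\<phi> \<one>\<^bsub>M\<^esub> = \<one>\<^bsub>N\<^esub>" "monoid M" "E \<subseteq> UNIV \<times> carrier M \<times> UNIV"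
  shows "walk N ((\<lambda>(p, a, q). (p, \<phi> a, q)) ` E) p g q \<longleftrightarrow> (\<exists>x. walk M E p x q \<and> g = \<phi> x)"
    (is "walk N ?E p g q \<longleftrightarrow> _")
proof
  show "walk N ?E p g q \<Longrightarrow> \<exists>x. walk M E p x q \<and> g = \<phi> x"
  proof (induction rule: walk.induct)
    case (Nil p)
    then show ?case using assms(2) by (metis walk.Nil)
  next
    case (Cons p b q g r)
    then obtain a x where "(p, a, q) \<in> E" "b = \<phi> a" "walk M E q x r" "g = \<phi> x" by auto
    moreover from this have "a \<in> carrier M" "x \<in> carrier M"
      using assms(4) walk_carrier[OF assms(3,4)] by blast+
    ultimately show ?case using hom_mult[OF assms(1)] by (metis walk.Cons)
  qed
  assume "\<exists>x. walk M E p x q \<and> g = \<phi> x"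
  then obtain x where "walk M E p x q" "g = \<phi> x" by blast
  from this(1) have "walk N ?E p (\<phi> x) q"
  proof (induction rule: walk.induct)
    case (Nil p)
    then show ?case by (simp add: assms(2) walk.Nil)
  next
    case (Cons p a q x r)
    then have "a \<in> carrier M" "x \<in> carrier M"
      using assms(4) walk_carrier[OF assms(3,4)] by blast+
    then have "\<phi> (a \<otimes>\<^bsub>M\<^esub> x) = \<phi> a \<otimes>\<^bsub>N\<^esub> \<phi> x" using hom_mult[OF assms(1)] by blast
    moreover have "(p, \<phi> a, q) \<in> ?E" using Cons(1) by force
    ultimately show ?case using walk.Cons[of p "\<phi> a" q ?E N "\<phi> x" r] Cons(3) by simp
  qed
  then show "walk N ?E p g q" using \<open>g = \<phi> x\<close> by simp
qed

lemma walk_of_rename: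
  assumes "inj f" "walk M ((\<lambda>(p, a, q). (f p, a, f q)) ` E) (f p) g (f q)"
  shows "walk M E p g q"
proof -
  have "walk M ((\<lambda>(p, a, q). (f p, a, f q)) ` E) x g y \<Longrightarrow> \<forall>p q. x = f p \<longrightarrow> y = f q \<longrightarrow> walk M E p g q"
    for x y g
  proof (induction rule: walk.induct)
    case (Nil p)
    then show ?case using assms(1) by (metis injD walk.Nil)
  next
    case (Cons x a y g z)
    then show ?case using injD[OF assms(1)] by (fastforce intro: walk.Cons)
  qed
  then show ?thesis using assms(2) by blast
qed

section \<open>Substitution of rational sets into finite graphs\<close>

lemma rational_walks:
  fixes E :: "('q::countable \<times> 'a \<times> 'q) set"
  assumes "finite E" "finite I" "finite F" "E \<subseteq> UNIV \<times> carrier M \<times> UNIV"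
  shows "rational M (walks M E I F)"
proof -
  let ?f = "to_nat :: 'q \<Rightarrow> nat"
  let ?E = "(\<lambda>(p, a, q). (?f p, a, ?f q)) ` E"
  have "walk M ?E (?f p) g (?f q) \<longleftrightarrow> walk M E p g q" for p g q
    using walk_of_rename[of ?f] walk_rename by (metis inj_to_nat)
  then have "walks M E I F = walks M ?E (?f ` I) (?f ` F)"
    unfolding walks_def by auto
  moreover have "?E \<subseteq> UNIV \<times> carrier M \<times> UNIV" using assms(4) by auto
  ultimately show ?thesis unfolding rational_def using assms(1,2,3)
    by (intro exI[of _ ?E] exI[of _ "?f ` I"] exI[of _ "?f ` F"]) simp
qed

text \<open>Edge \<open>k\<close> is replaced by a private copy of a finite graph for
  \<open>R k\<close>, attached to the old states by unit edges. An old state \<open>s\<close>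
  becomes \<open>Inl s\<close> and a state \<open>x\<close> of the copy becomes
  \<open>Inr (k, x)\<close>; since the copies are disjoint, a walk that enters copy \<open>k\<close>
  can leave it only at \<open>tgt k\<close>.\<close>

lemma rational_substitute_indexed:
  fixes src tgt :: "nat \<Rightarrow> 's::countable"
  assumes M: "monoid M" and fin: "finite K" "finite I" "finite F"
    and R: "\<And>k. k \<in> K \<Longrightarrow> rational M (R k)"
  shows "rational M (walks M {(src k, g, tgt k) |k g. k \<in> K \<and> g \<in> R k} I F)"
    (is "rational M (walks M ?N I F)")
proof -
  interpret monoid M by fact
  have "\<forall>k\<in>K. \<exists>(E :: (nat \<times> 'a \<times> nat) set) I F. finite E \<and> finite I \<and> finite F \<and>
        E \<subseteq> UNIV \<times> carrier M \<times> UNIV \<and> R k = walks M E I F"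
    using R unfolding rational_def by blast
  then obtain e i f where eif: "\<And>k. k \<in> K \<Longrightarrow> finite (e k :: (nat \<times> 'a \<times> nat) set) \<and>
      finite (i k) \<and> finite (f k) \<and> e k \<subseteq> UNIV \<times> carrier M \<times> UNIV \<and> R k = walks M (e k) (i k) (f k)"
    by metis
  define E :: "(('s + nat \<times> nat) \<times> 'a \<times> ('s + nat \<times> nat)) set" where
    "E = (\<Union>k\<in>K. (\<lambda>x. (Inl (src k), \<one>\<^bsub>M\<^esub>, Inr (k, x))) ` i k \<union>
                  (\<lambda>(x, a, y). (Inr (k, x), a, Inr (k, y))) ` e k \<union>
                  (\<lambda>x. (Inr (k, x), \<one>\<^bsub>M\<^esub>, Inl (tgt k))) ` f k)"
  have finE: "finite E" unfolding E_def using fin eif by auto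
  have carE: "E \<subseteq> UNIV \<times> carrier M \<times> UNIV" using eif unfolding E_def by fast
  have E_in: "(Inl (src k), \<one>\<^bsub>M\<^esub>, Inr (k, x)) \<in> E" if "k \<in> K" "x \<in> i k" for k x
    unfolding E_def using that by blast
  have E_step: "(Inr (k, x), a, Inr (k, y)) \<in> E" if "k \<in> K" "(x, a, y) \<in> e k" for k x a y
    unfolding E_def using that by force
  have E_out: "(Inr (k, x), \<one>\<^bsub>M\<^esub>, Inl (tgt k)) \<in> E" if "k \<in> K" "x \<in> f k" for k x
    unfolding E_def using that by blast
  have carR: "g \<in> carrier M" if "k \<in> K" "g \<in> R k" for k g
    using rational_subset_carrier[OF M] R that by blast
  have single: "walk M E (Inl (src k)) g (Inl (tgt k))" if k: "k \<in> K" "g \<in> R k" for k g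
  proof -
    obtain x y where xy: "x \<in> i k" "y \<in> f k" "walk M (e k) x g y"
      using eif[OF k(1)] k(2) unfolding walks_def by blast
    have "walk M ((\<lambda>(p, a, q). (Inr (k, p), a, Inr (k, q))) ` e k) (Inr (k, x)) g (Inr (k, y))"
      using walk_rename[OF xy(3), of "\<lambda>x. Inr (k, x)"] by simp
    then have "walk M E (Inr (k, x)) g (Inr (k, y))"
      by (rule walk_mono) (use E_step[OF k(1)] in auto)
    from this walk_single[OF M E_out[OF k(1) xy(2)] one_closed]
    have "walk M E (Inr (k, x)) (g \<otimes>\<^bsub>M\<^esub> \<one>\<^bsub>M\<^esub>) (Inl (tgt k))"
      by (rule walk_trans[OF M carE])
    with walk_single[OF M E_in[OF k(1) xy(1)] one_closed]
    have "walk M E (Inl (src k)) (\<one>\<^bsub>M\<^esub> \<otimes>\<^bsub>M\<^esub> (g \<otimes>\<^bsub>M\<^esub> \<one>\<^bsub>M\<^esub>)) (Inl (tgt k))"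
      by (rule walk_trans[OF M carE])
    then show ?thesis using carR[OF k] by simp
  qed
  have to: "walk M E (Inl p) g (Inl q)" if "walk M ?N p g q" for p g q
    using that
  proof (induction rule: walk.induct)
    case (Nil p)
    then show ?case by (rule walk.Nil)
  next
    case (Cons p a q g r)
    then obtain k where k: "k \<in> K" "a \<in> R k" "p = src k" "q = tgt k" by blast
    show ?case using single[OF k(1,2)] Cons(3) unfolding k by (rule walk_trans[OF M carE])
  qed
  have carN: "?N \<subseteq> UNIV \<times> carrier M \<times> UNIV" using carR by blast
  \<comment> \<open>A walk between old states passes through copies, so the induction needs a claim
    about walks that start inside one: such a walk splits into the rest of its run through the copy
    and a walk of the outer graph.\<close>
  have from_aux: "(\<forall>p. s = Inl p \<longrightarrow> walk M ?N p g q) \<and>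
      (\<forall>k a. s = Inr (k, a) \<longrightarrow> k \<in> K \<longrightarrow> (\<exists>x y b. g = x \<otimes>\<^bsub>M\<^esub> y \<and> b \<in> f k \<and> walk M (e k) a x b \<and> walk M ?N (tgt k) y q))"
    if "walk M E s g t" "t = Inl q" for s g t q
    using that
  proof (induction rule: walk.induct)
    case (Nil p)
    then show ?case by (auto intro: walk.Nil)
  next
    case (Cons s a t g u)
    have IH1: "walk M ?N p g q" if "t = Inl p" for p using Cons(3)[OF Cons(4)] that by blast
    have IH2: "\<exists>x y b. g = x \<otimes>\<^bsub>M\<^esub> y \<and> b \<in> f k \<and> walk M (e k) a x b \<and> walk M ?N (tgt k) y q"
      if "t = Inr (k, a)" "k \<in> K" for k a using Cons(3)[OF Cons(4)] that by blast
    have g: "g \<in> carrier M" using Cons(2) walk_carrier[OF M carE] by blast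
    show ?case
    proof (intro conjI allI impI)
      fix p assume "s = Inl p"
      then obtain k x where k: "k \<in> K" "x \<in> i k" "p = src k" "a = \<one>\<^bsub>M\<^esub>" "t = Inr (k, x)"
        using Cons(1) unfolding E_def by auto
      then obtain v y b where vy: "g = v \<otimes>\<^bsub>M\<^esub> y" "b \<in> f k" "walk M (e k) x v b" "walk M ?N (tgt k) y q"
        using IH2[OF k(5,1)] by blast
      have "v \<in> R k" using k(1,2) vy(2,3) eif[OF k(1)] unfolding walks_def by blast
      then have "(p, v, tgt k) \<in> ?N" using k by blast
      then have "walk M ?N p (v \<otimes>\<^bsub>M\<^esub> y) q" using vy(4) by (rule walk.Cons)
      then show "walk M ?N p (a \<otimes>\<^bsub>M\<^esub> g) q" using vy k g by simp
    next
      fix k x assume s: "s = Inr (k, x)" and k: "k \<in> K"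
      then consider (e) y where "(x, a, y) \<in> e k" "t = Inr (k, y)"
        | (f) "x \<in> f k" "a = \<one>\<^bsub>M\<^esub>" "t = Inl (tgt k)"
        using Cons(1) unfolding E_def by auto
      then show "\<exists>v y b. a \<otimes>\<^bsub>M\<^esub> g = v \<otimes>\<^bsub>M\<^esub> y \<and> b \<in> f k \<and> walk M (e k) x v b \<and> walk M ?N (tgt k) y q"
      proof cases
        case e
        obtain v y' b where vy: "g = v \<otimes>\<^bsub>M\<^esub> y'" "b \<in> f k" "walk M (e k) y v b" "walk M ?N (tgt k) y' q"
          using IH2[OF e(2) k] by blast
        have "a \<in> carrier M" using e(1) eif[OF k] by blast
        moreover have "v \<in> carrier M" using walk_carrier[OF M _ vy(3)] eif[OF k] by blast
        moreover have "y' \<in> carrier M" using walk_carrier[OF M carN vy(4)] .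
        ultimately have "a \<otimes>\<^bsub>M\<^esub> g = (a \<otimes>\<^bsub>M\<^esub> v) \<otimes>\<^bsub>M\<^esub> y'" using vy by (simp add: m_assoc)
        moreover have "walk M (e k) x (a \<otimes>\<^bsub>M\<^esub> v) b" using e(1) vy(3) by (rule walk.Cons)
        ultimately show ?thesis using vy by blast
      next
        case f
        from IH1[OF f(3)] f(1,2) g show ?thesis by (intro exI[of _ "\<one>\<^bsub>M\<^esub>"] exI[of _ g] exI[of _ x]) (simp add: walk.Nil)
      qed
    qed
  qed
  have "walk M ?N p g q \<longleftrightarrow> walk M E (Inl p) g (Inl q)" for p g q
    using to from_aux by blast
  then have "walks M ?N I F = walks M E (Inl ` I) (Inl ` F)" unfolding walks_def by auto
  also have "rational M \<dots>"
    using fin by (intro rational_walks finE carE) auto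
  finally show ?thesis .
qed

text \<open>The labels are subsets of an arbitrary type and cannot serve as part of a countable
  state, so the finitely many edges are numbered first.\<close>

lemma rational_substitute:
  fixes N :: "('s::countable \<times> 'a set \<times> 's) set"
  assumes M: "monoid M" and "finite N" "finite I" "finite F"
    and R: "\<And>p R q. (p, R, q) \<in> N \<Longrightarrow> rational M R"
  shows "rational M (walks M {(p, g, q). \<exists>R. (p, R, q) \<in> N \<and> g \<in> R} I F)"
proof -
  obtain m :: nat and h where h: "N = h ` {i. i < m}"
    using finite_imp_nat_seg_image_inj_on[OF assms(2)] by blast
  have "{(p, g, q). \<exists>R. (p, R, q) \<in> N \<and> g \<in> R} =
    {(fst (h k), g, snd (snd (h k))) |k g. k \<in> {i. i < m} \<and> g \<in> fst (snd (h k))}" (is "?A = ?B")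
  proof
    show "?A \<subseteq> ?B"
    proof clarify
      fix p g q R assume "(p, R, q) \<in> N" "g \<in> R"
      moreover then obtain k where "k < m" "h k = (p, R, q)" unfolding h by auto
      ultimately show "\<exists>k g'. (p, g, q) = (fst (h k), g', snd (snd (h k))) \<and> k \<in> {i. i < m} \<and> g' \<in> fst (snd (h k))"
        by (intro exI[of _ k] exI[of _ g]) simp
    qed
    show "?B \<subseteq> ?A"
    proof clarify
      fix k g assume k: "k < m" "g \<in> fst (snd (h k))"
      then have "(fst (h k), fst (snd (h k)), snd (snd (h k))) \<in> N" unfolding h by simp
      then show "\<exists>R. (fst (h k), R, snd (snd (h k))) \<in> N \<and> g \<in> R" using k(2) by blast
    qed
  qed
  moreover have "rational M (fst (snd (h k)))" if "k \<in> {i. i < m}" for k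
    using R[of "fst (h k)" "fst (snd (h k))" "snd (snd (h k))"] that unfolding h by simp
  ultimately show ?thesis
    using rational_substitute_indexed[OF M, of "{i. i < m}" I F "\<lambda>k. fst (snd (h k))" "\<lambda>k. fst (h k)"
        "\<lambda>k. snd (snd (h k))"] assms(3,4) by simp
qed

section \<open>Closure properties of rational sets\<close>

lemma walks_single [simp]: "walks M E {p} {q} = {g. walk M E p g q}"
  by (simp add: walks_def)

lemma walk_iff:
  "walk M E p g r \<longleftrightarrow> g = \<one>\<^bsub>M\<^esub> \<and> r = p \<or> (\<exists>a q h. (p, a, q) \<in> E \<and> walk M E q h r \<and> g = a \<otimes>\<^bsub>M\<^esub> h)"
proof
  assume "walk M E p g r"
  then show "g = \<one>\<^bsub>M\<^esub> \<and> r = p \<or> (\<exists>a q h. (p, a, q) \<in> E \<and> walk M E q h r \<and> g = a \<otimes>\<^bsub>M\<^esub> h)"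
    by cases blast+
qed (metis walk.intros)

lemma walks_one_step:
  assumes "monoid M" "p \<noteq> r" "A \<subseteq> carrier M"
  shows "walks M ({p} \<times> A \<times> {r}) {p} {r} = A"
proof -
  have r: "walk M ({p} \<times> A \<times> {r}) r h r \<longleftrightarrow> h = \<one>\<^bsub>M\<^esub>" for h
    using walk_iff[of M "{p} \<times> A \<times> {r}" r h r] assms(2) by simp
  have "walk M ({p} \<times> A \<times> {r}) p g r \<longleftrightarrow> (\<exists>a\<in>A. g = a \<otimes>\<^bsub>M\<^esub> \<one>\<^bsub>M\<^esub>)" for g
    using walk_iff[of M "{p} \<times> A \<times> {r}" p g r] assms(2) r by auto
  moreover have "(\<exists>a\<in>A. g = a \<otimes>\<^bsub>M\<^esub> \<one>\<^bsub>M\<^esub>) \<longleftrightarrow> g \<in> A" for g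
    using assms(1,3) by (metis monoid.r_one subsetD)
  ultimately show ?thesis unfolding walks_single by blast
qed

lemma rational_singleton:
  assumes "monoid M" "g \<in> carrier M"
  shows "rational M {g}"
proof -
  have "{g} = walks M ({0} \<times> {g} \<times> {Suc 0}) {0} {Suc 0}"
    using assms by (intro walks_one_step[symmetric]) auto
  also have "rational M \<dots>" using assms(2) by (intro rational_walks) auto
  finally show ?thesis .
qed

lemma rational_union:
  assumes M: "monoid M" and S: "rational M S" and T: "rational M T"
  shows "rational M (S \<union> T)"
proof -
  let ?N = "{(0, S, Suc 0), (0, T, Suc 0)}"
  let ?E = "{(p, g, q). \<exists>R. (p, R, q) \<in> ?N \<and> g \<in> R}"
  have E: "?E = {0} \<times> (S \<union> T) \<times> {Suc 0}" by auto
  have "S \<union> T = walks M ?E {0} {Suc 0}" unfolding E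
    using rational_subset_carrier[OF M S] rational_subset_carrier[OF M T] M
    by (intro walks_one_step[symmetric]) auto
  also have "rational M \<dots>"
    by (rule rational_substitute[OF M]) (use S T in auto)
  finally show ?thesis .
qed

lemma rational_mult_right:
  assumes M: "monoid M" and S: "rational M S" and c: "c \<in> carrier M"
  shows "rational M ((\<lambda>g. g \<otimes>\<^bsub>M\<^esub> c) ` S)"
proof -
  let ?N = "{(0, S, Suc 0), (Suc 0, {c}, Suc (Suc 0))}"
  let ?E = "{(p, g, q). \<exists>R. (p, R, q) \<in> ?N \<and> g \<in> R}"
  have 2: "walk M ?E (Suc (Suc 0)) h (Suc (Suc 0)) \<longleftrightarrow> h = \<one>\<^bsub>M\<^esub>" for h
    using walk_iff[of M ?E "Suc (Suc 0)" h "Suc (Suc 0)"] by simp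
  have 1: "walk M ?E (Suc 0) h (Suc (Suc 0)) \<longleftrightarrow> h = c" for h
    using walk_iff[of M ?E "Suc 0" h "Suc (Suc 0)"] c 2 by (simp add: monoid.r_one[OF M])
  have 0: "walk M ?E 0 h (Suc (Suc 0)) \<longleftrightarrow> (\<exists>s\<in>S. h = s \<otimes>\<^bsub>M\<^esub> c)" for h
    using walk_iff[of M ?E 0 h "Suc (Suc 0)"] 1 by auto
  have "(\<lambda>g. g \<otimes>\<^bsub>M\<^esub> c) ` S = walks M ?E {0} {Suc (Suc 0)}"
    unfolding walks_single 0 by blast
  also have "rational M \<dots>"
    by (rule rational_substitute[OF M]) (use S rational_singleton[OF M c] in auto)
  finally show ?thesis .
qed

lemma rational_image:
  assumes "\<phi> \<in> hom M N" "\<phi> \<one>\<^bsub>M\<^esub> = \<one>\<^bsub>N\<^esub>" "monoid M" "rational M S"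
  shows "rational N (\<phi> ` S)"
proof -
  obtain E :: "(nat \<times> 'a \<times> nat) set" and I F where E: "finite E" "finite I" "finite F"
    "E \<subseteq> UNIV \<times> carrier M \<times> UNIV" "S = walks M E I F"
    using assms(4) unfolding rational_def by blast
  have "\<phi> ` S = walks N ((\<lambda>(p, a, q). (p, \<phi> a, q)) ` E) I F"
    unfolding E(5) walks_def walk_relabel[OF assms(1-3) E(4)] by blast
  also have "rational N \<dots>"
    using E hom_in_carrier[OF assms(1)] by (intro rational_walks) auto
  finally show ?thesis .
qed

text \<open>Reversing a walk reverses the order of its labels, which is what inversion does to the
  factors of a product.\<close>

lemma walk_inverse:
  assumes "group M" "E \<subseteq> UNIV \<times> carrier M \<times> UNIV" "walk M E p g q"
  shows "walk M ((\<lambda>(p, a, q). (q, inv\<^bsub>M\<^esub> a, p)) ` E) q (inv\<^bsub>M\<^esub> g) p" (is "walk M ?E _ _ _")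
proof -
  interpret group M by fact
  have car: "?E \<subseteq> UNIV \<times> carrier M \<times> UNIV" using assms(2) by auto
  show ?thesis using assms(3)
  proof (induction rule: walk.induct)
    case (Nil p)
    then show ?case by (simp add: walk.Nil)
  next
    case (Cons p a q g r)
    have "a \<in> carrier M" "g \<in> carrier M"
      using Cons assms(2) walk_carrier[OF is_monoid assms(2)] by blast+
    moreover have "walk M ?E q (inv\<^bsub>M\<^esub> a) p"
      using Cons(1) assms(2) by (intro walk_single) force+
    ultimately show ?case
      using walk_trans[OF is_monoid car Cons(3)] by (simp add: inv_mult_group)
  qed
qed

lemma rational_inverse:
  assumes "group M" "rational M S"
  shows "rational M (m_inv M ` S)"
proof -
  interpret group M by fact
  obtain E :: "(nat \<times> 'a \<times> nat) set" and I F where E: "finite E" "finite I" "finite F"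
    "E \<subseteq> UNIV \<times> carrier M \<times> UNIV" "S = walks M E I F"
    using assms(2) unfolding rational_def by blast
  let ?E = "(\<lambda>(p, a, q). (q, inv\<^bsub>M\<^esub> a, p)) ` E"
  have car: "?E \<subseteq> UNIV \<times> carrier M \<times> UNIV" using E(4) by auto
  \<comment> \<open>Reversal is an involution on graphs, so the second inclusion comes from the same
    lemma applied to the reversed graph.\<close>
  have "(\<lambda>(p, a, q). (q, inv\<^bsub>M\<^esub> a, p)) ` ?E = E"
    using E(4) by (force simp: image_image case_prod_unfold)
  then have inv_walk: "walk M E p (inv\<^bsub>M\<^esub> g) q" if "walk M ?E q g p" for p g q
    using walk_inverse[OF assms(1) car that] by simp
  have "m_inv M ` S = walks M ?E F I"
  proof
    show "m_inv M ` S \<subseteq> walks M ?E F I"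
    proof
      fix g assume "g \<in> m_inv M ` S"
      then obtain p q h where "p \<in> I" "q \<in> F" "walk M E p h q" "g = inv\<^bsub>M\<^esub> h"
        unfolding E(5) walks_def by auto
      moreover then have "walk M ?E q g p" using walk_inverse[OF assms(1) E(4)] by simp
      ultimately show "g \<in> walks M ?E F I" unfolding walks_def by blast
    qed
    show "walks M ?E F I \<subseteq> m_inv M ` S"
    proof
      fix g assume "g \<in> walks M ?E F I"
      then obtain p q where pq: "p \<in> F" "q \<in> I" "walk M ?E p g q" unfolding walks_def by blast
      then have "inv\<^bsub>M\<^esub> g \<in> S" using inv_walk unfolding E(5) walks_def by blast
      moreover have "g \<in> carrier M" using walk_carrier[OF is_monoid car pq(3)] .
      ultimately show "g \<in> m_inv M ` S" by (metis image_eqI inv_inv)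
    qed
  qed
  also have "rational M \<dots>" using E car by (intro rational_walks) auto
  finally show ?thesis .
qed

section \<open>Rational sets and regular languages\<close>

text \<open>The transition graph of the automaton, with each letter replaced by its image under
  \<pi>, is a graph for the image of the language. The second conclusion records finite generation:
  the carrier is the image of all words.\<close>

lemma regular_set_imp_rational:
  assumes "monoid M" "regular_set M P"
  shows "rational M P" "rational M (carrier M)"
proof -
  interpret monoid M by fact
  obtain Alph \<pi> L where A: "finite Alph" "word_hom Alph M \<pi>" "\<pi> ` lists Alph = carrier M"
    "regular_lang Alph L" "\<pi> ` L = P"
    using assms(2) unfolding regular_set_def by blast
  have \<pi>: "\<pi> [] = \<one>\<^bsub>M\<^esub>" "\<And>x w. x \<in> Alph \<Longrightarrow> w \<in> lists Alph \<Longrightarrow> \<pi> (x # w) = \<pi> [x] \<otimes>\<^bsub>M\<^esub> \<pi> w"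
    "\<And>x. x \<in> Alph \<Longrightarrow> \<pi> [x] \<in> carrier M"
  proof -
    show "\<pi> [] = \<one>\<^bsub>M\<^esub>" using A(2) unfolding word_hom_def by blast
    show "\<pi> [x] \<in> carrier M" if "x \<in> Alph" for x using A(2) that unfolding word_hom_def by simp
    show "\<pi> (x # w) = \<pi> [x] \<otimes>\<^bsub>M\<^esub> \<pi> w" if "x \<in> Alph" "w \<in> lists Alph" for x w
    proof -
      have "[x] \<in> lists Alph" using that by simp
      then have "\<pi> ([x] @ w) = \<pi> [x] \<otimes>\<^bsub>M\<^esub> \<pi> w" using A(2) that unfolding word_hom_def by blast
      then show ?thesis by simp
    qed
  qed
  have main: "rational M (\<pi> ` {w \<in> lists Alph. foldl tr s0 w \<in> Fin})"
    if fin: "finite St" "s0 \<in> St" "\<forall>q\<in>St. \<forall>x\<in>Alph. tr q x \<in> St" "Fin \<subseteq> St"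
    for St :: "nat set" and s0 tr Fin
  proof -
    define E where "E = (\<lambda>(q, x). (q, \<pi> [x], tr q x)) ` (St \<times> Alph)"
    have to: "walk M E p (\<pi> w) (foldl tr p w)" if "w \<in> lists Alph" "p \<in> St" for p w
      using that
    proof (induction w arbitrary: p)
      case Nil
      then show ?case by (simp add: \<pi> walk.Nil)
    next
      case (Cons x w)
      then have "(p, \<pi> [x], tr p x) \<in> E" unfolding E_def by force
      moreover have "walk M E (tr p x) (\<pi> w) (foldl tr (tr p x) w)" using Cons fin by simp
      ultimately have "walk M E p (\<pi> [x] \<otimes>\<^bsub>M\<^esub> \<pi> w) (foldl tr (tr p x) w)" by (rule walk.Cons)
      moreover have "\<pi> (x # w) = \<pi> [x] \<otimes>\<^bsub>M\<^esub> \<pi> w" using Cons by (intro \<pi>(2)) auto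
      ultimately show ?case by simp
    qed
    have from_walk: "\<exists>w\<in>lists Alph. g = \<pi> w \<and> q = foldl tr p w" if "walk M E p g q" for p g q
      using that
    proof (induction rule: walk.induct)
      case (Nil p)
      then show ?case by (intro bexI[of _ "[]"]) (auto simp: \<pi>)
    next
      case (Cons p a q g r)
      from Cons(1) obtain x where x: "x \<in> Alph" "a = \<pi> [x]" "q = tr p x" unfolding E_def by auto
      from Cons(3) obtain w where w: "w \<in> lists Alph" "g = \<pi> w" "r = foldl tr q w" by blast
      show ?case using x w \<pi>(2)[OF x(1) w(1)] by (intro bexI[of _ "x # w"]) simp_all
    qed
    have "\<pi> ` {w \<in> lists Alph. foldl tr s0 w \<in> Fin} = walks M E {s0} Fin"
    proof
      show "\<pi> ` {w \<in> lists Alph. foldl tr s0 w \<in> Fin} \<subseteq> walks M E {s0} Fin"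
        unfolding walks_def using to[OF _ fin(2)] by auto
      show "walks M E {s0} Fin \<subseteq> \<pi> ` {w \<in> lists Alph. foldl tr s0 w \<in> Fin}"
        unfolding walks_def by (auto dest!: from_walk)
    qed
    also have "rational M \<dots>"
      using fin A(1) finite_subset[OF fin(4,1)] by (intro rational_walks) (auto simp: E_def \<pi>(3))
    finally show ?thesis .
  qed
  show "rational M P"
  proof -
    obtain St :: "nat set" and s0 tr Fin where
      "finite St" "s0 \<in> St" "\<forall>q\<in>St. \<forall>x\<in>Alph. tr q x \<in> St" "Fin \<subseteq> St"
      "L = {w \<in> lists Alph. foldl tr s0 w \<in> Fin}"
      using A(4) unfolding regular_lang_def by (elim exE conjE)
    then show ?thesis using main A(5) by blast
  qed
  \<comment> \<open>The automaton with the single state 0 accepts every word, so \<open>main\<close>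
    applies to the carrier too.\<close>
  have "{w \<in> lists Alph. foldl (\<lambda>q x. q) 0 w \<in> {0::nat}} = lists Alph"
  proof -
    have "foldl (\<lambda>q x. q) (0::nat) w = 0" for w :: "nat list" by (induction w) auto
    then show ?thesis by auto
  qed
  then show "rational M (carrier M)" using main[of "{0}" 0 "\<lambda>q x. q" "{0}"] A(3) by simp
qed

text \<open>Every label becomes a letter, the unit included, so there are no empty transitions. The
  graph is nondeterministic while \<open>regular_lang\<close> asks for a transition function, hence
  the subset construction, with finite sets of states coded as naturals by
  \<open>set_encode\<close>.\<close>

lemma rational_imp_regular_set:
  assumes "monoid M" "rational M P" "rational M (carrier M)"
  shows "regular_set M P"
proof -
  interpret monoid M by fact
  obtain E :: "(nat \<times> 'a \<times> nat) set" and I F where E: "finite E" "finite I" "finite F"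
    "E \<subseteq> UNIV \<times> carrier M \<times> UNIV" "P = walks M E I F"
    using assms(2) unfolding rational_def by blast
  obtain E' :: "(nat \<times> 'a \<times> nat) set" and I' F' where E': "finite E'" "finite I'" "finite F'"
    "E' \<subseteq> UNIV \<times> carrier M \<times> UNIV" "carrier M = walks M E' I' F'"
    using assms(3) unfolding rational_def by blast
  \<comment> \<open>The labels of the graph for the carrier are added to the alphabet to make \<pi>
    surjective.\<close>
  define B where "B = (fst \<circ> snd) ` (E \<union> E')"
  have "finite B" unfolding B_def using E E' by simp
  then obtain m :: nat and f where "B = f ` {i. i < m}"
    using finite_imp_nat_seg_image_inj_on by blast
  then have f: "B = f ` {..<m}" by (simp add: lessThan_def)
  have Bcar: "B \<subseteq> carrier M" unfolding B_def using E E' by auto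
  define \<pi> where "\<pi> w = foldr (\<lambda>x g. f x \<otimes>\<^bsub>M\<^esub> g) w \<one>\<^bsub>M\<^esub>" for w
  have \<pi>_simps [simp]: "\<pi> [] = \<one>\<^bsub>M\<^esub>" "\<pi> (x # w) = f x \<otimes>\<^bsub>M\<^esub> \<pi> w" for x w
    unfolding \<pi>_def by auto
  have fcar: "f x \<in> carrier M" if "x < m" for x using that f Bcar by auto
  have \<pi>car: "\<pi> w \<in> carrier M" if "w \<in> lists {..<m}" for w
    using that by (induction w) (auto intro: fcar)
  have "\<pi> (u @ v) = \<pi> u \<otimes>\<^bsub>M\<^esub> \<pi> v" if "u \<in> lists {..<m}" "v \<in> lists {..<m}" for u v
    using that by (induction u) (auto simp: \<pi>car fcar m_assoc)
  then have hom: "word_hom {..<m} M \<pi>" unfolding word_hom_def using \<pi>car by simp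
  define Q where "Q = I \<union> (\<Union>(p, a, q)\<in>E. {p, q})"
  have Q: "finite Q" "I \<subseteq> Q" "\<And>p a q. (p, a, q) \<in> E \<Longrightarrow> q \<in> Q"
    unfolding Q_def using E by auto
  define tr where "tr s x = set_encode {q. \<exists>p\<in>set_decode s. (p, f x, q) \<in> E}" for s x
  define St where "St = set_encode ` Pow Q"
  define Fin where "Fin = set_encode ` {S. S \<subseteq> Q \<and> S \<inter> F \<noteq> {}}"
  have dec: "set_decode (tr s x) = {q. \<exists>p\<in>set_decode s. (p, f x, q) \<in> E}" for s x
  proof -
    have "{q. \<exists>p\<in>set_decode s. (p, f x, q) \<in> E} \<subseteq> Q" using Q by auto
    then show ?thesis unfolding tr_def using Q(1) finite_subset by (intro set_encode_inverse) blast
  qed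
  have mem: "s \<in> St \<longleftrightarrow> set_decode s \<subseteq> Q" for s
  proof
    show "s \<in> St \<Longrightarrow> set_decode s \<subseteq> Q" unfolding St_def using Q(1) by (auto simp: finite_subset)
    show "set_decode s \<subseteq> Q \<Longrightarrow> s \<in> St" unfolding St_def by (intro image_eqI[of _ _ "set_decode s"]) auto
  qed
  have memF: "s \<in> Fin \<longleftrightarrow> set_decode s \<subseteq> Q \<and> set_decode s \<inter> F \<noteq> {}" for s
  proof
    show "s \<in> Fin \<Longrightarrow> set_decode s \<subseteq> Q \<and> set_decode s \<inter> F \<noteq> {}"
      unfolding Fin_def using Q(1) by (auto simp: finite_subset)
    show "set_decode s \<subseteq> Q \<and> set_decode s \<inter> F \<noteq> {} \<Longrightarrow> s \<in> Fin"
      unfolding Fin_def by (intro image_eqI[of _ _ "set_decode s"]) auto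
  qed
  have run_walk: "\<exists>p\<in>set_decode s. walk M E p (\<pi> w) q"
    if "w \<in> lists {..<m}" "q \<in> set_decode (foldl tr s w)" for w q s
    using that
  proof (induction w arbitrary: s)
    case Nil
    then show ?case by (auto intro: walk.Nil)
  next
    case (Cons x w)
    then obtain p' where "p' \<in> set_decode (tr s x)" "walk M E p' (\<pi> w) q" by auto
    then show ?case unfolding dec by (auto intro: walk.Cons)
  qed
  \<comment> \<open>The word is found before the state set \<open>s\<close> is given, so the
    induction hypothesis can be used at \<open>tr s x\<close>.\<close>
  have walk_run: "\<exists>w\<in>lists {..<m}. g = \<pi> w \<and> (\<forall>s. p \<in> set_decode s \<longrightarrow> q \<in> set_decode (foldl tr s w))"
    if "walk M E p g q" for p g q
    using that
  proof (induction rule: walk.induct)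
    case (Nil p)
    then show ?case by (intro bexI[of _ "[]"]) auto
  next
    case (Cons p a q g r)
    then obtain w where w: "w \<in> lists {..<m}" "g = \<pi> w" "\<And>s. q \<in> set_decode s \<Longrightarrow> r \<in> set_decode (foldl tr s w)"
      by blast
    have "a \<in> B" using Cons(1) unfolding B_def by force
    then obtain x where x: "x < m" "a = f x" using f by auto
    then have "r \<in> set_decode (foldl tr s (x # w))" if "p \<in> set_decode s" for s
      using that w(3)[of "tr s x"] Cons(1) dec by auto
    then show ?case using w x by (intro bexI[of _ "x # w"]) auto
  qed
  have gen: "\<exists>w\<in>lists {..<m}. g = \<pi> w" if "walk M E' p g q" for p g q
    using that
  proof (induction rule: walk.induct)
    case (Nil p)
    then show ?case by (intro bexI[of _ "[]"]) auto
  next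
    case (Cons p a q g r)
    then obtain w where w: "w \<in> lists {..<m}" "g = \<pi> w" by blast
    have "a \<in> B" using Cons(1) unfolding B_def by force
    then obtain x where x: "x < m" "a = f x" using f by auto
    then show ?case using w x by (intro bexI[of _ "x # w"]) auto
  qed
  have surj: "\<pi> ` lists {..<m} = carrier M"
  proof
    show "\<pi> ` lists {..<m} \<subseteq> carrier M" using \<pi>car by blast
    show "carrier M \<subseteq> \<pi> ` lists {..<m}" using gen unfolding E'(5) walks_def by blast
  qed
  define L where "L = {w \<in> lists {..<m}. foldl tr (set_encode I) w \<in> Fin}"
  have trSt: "\<forall>q\<in>St. \<forall>x\<in>{..<m}. tr q x \<in> St"
    unfolding mem dec using Q(3) by auto
  have decI: "set_decode (set_encode I) = I" using E(2) by simp
  have foldSt: "set_decode (foldl tr s w) \<subseteq> Q" if "set_decode s \<subseteq> Q" for s w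
    using that
  proof (induction w arbitrary: s)
    case (Cons x w)
    have "set_decode (tr s x) \<subseteq> Q" unfolding dec using Q(3) by blast
    then show ?case using Cons.IH by simp
  qed simp
  have reg: "regular_lang {..<m} L"
    unfolding regular_lang_def
  proof (intro exI conjI)
    show "finite St" unfolding St_def using Q(1) by simp
    show "set_encode I \<in> St" unfolding mem decI by (rule Q(2))
    show "Fin \<subseteq> St" using mem memF by blast
  qed (use trSt in \<open>simp_all add: L_def\<close>)
  have "\<pi> ` L = P"
  proof
    show "\<pi> ` L \<subseteq> P"
    proof
      fix g assume "g \<in> \<pi> ` L"
      then obtain w q where "w \<in> lists {..<m}" "g = \<pi> w" "q \<in> F" "q \<in> set_decode (foldl tr (set_encode I) w)"
        unfolding L_def memF by blast
      then show "g \<in> P" using run_walk[of w q "set_encode I"] decI unfolding E(5) walks_def by auto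
    qed
    show "P \<subseteq> \<pi> ` L"
    proof
      fix g assume "g \<in> P"
      then obtain p q where pq: "p \<in> I" "q \<in> F" "walk M E p g q" unfolding E(5) walks_def by blast
      then obtain w where "w \<in> lists {..<m}" "g = \<pi> w" "q \<in> set_decode (foldl tr (set_encode I) w)"
        using walk_run[OF pq(3)] decI by blast
      then show "g \<in> \<pi> ` L" unfolding L_def memF using pq(2) foldSt[of "set_encode I"] decI Q(2) by auto
    qed
  qed
  then show ?thesis unfolding regular_set_def
    using hom surj reg by (intro exI[of _ "{..<m}"] exI[of _ \<pi>] exI[of _ L]) (auto simp: L_def)
qed

section \<open>Weights of alternating products\<close>

definition jump :: "nat \<Rightarrow> nat \<Rightarrow> int" where
  "jump i j = sgn (int j - int i)"

definition cone_sgn :: "'a set \<Rightarrow> 'a \<Rightarrow> int" where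
  "cone_sgn Q x = (if x \<in> Q then 1 else -1)"

text \<open>The product is kept as an element and not as a word, so that a factor from
  \<open>H\<close> disappears into a syllable. The first and last indices are recorded because they
  determine the jump at a junction. The predicate stands outside the locale below since one of the
  locale's assumptions speaks of it.\<close>

inductive alternating ::
  "('a, 'b) monoid_scheme \<Rightarrow> nat set \<Rightarrow> (nat \<Rightarrow> 'a set) \<Rightarrow> 'a set \<Rightarrow> (nat \<Rightarrow> 'a set)
    \<Rightarrow> 'a \<Rightarrow> int \<Rightarrow> nat \<Rightarrow> nat \<Rightarrow> bool"
  for A I F H Q where
  single: "i \<in> I \<Longrightarrow> x \<in> F i - H \<Longrightarrow> alternating A I F H Q x (cone_sgn (Q i) x) i i"
| snoc: "alternating A I F H Q g t a b \<Longrightarrow> i \<in> I \<Longrightarrow> i \<noteq> b \<Longrightarrow> x \<in> F i - H \<Longrightarrow>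
    alternating A I F H Q (g \<otimes>\<^bsub>A\<^esub> x) (t + jump b i + cone_sgn (Q i) x) a i"

text \<open>This separates the ordering argument from the construction of the amalgam: of freeness
  only \<open>alternating_nontrivial\<close> is retained. Disjointness of \<open>P\<close> from its
  inverses follows from \<open>P_mult\<close> and \<open>one_notin_P\<close>.\<close>

locale relatively_ordered_factors = group A for A (structure) +
  fixes I :: "nat set" and F :: "nat \<Rightarrow> 'a set" and H :: "'a set" and Q :: "nat \<Rightarrow> 'a set" and P :: "'a set"
  assumes finite_I: "finite I"
    and F_subgroup: "\<And>i. i \<in> I \<Longrightarrow> subgroup (F i) A"
    and H_subgroup: "subgroup H A"
    and H_subset: "\<And>i. i \<in> I \<Longrightarrow> H \<subseteq> F i"
    and Q_mult: "\<And>i x y. i \<in> I \<Longrightarrow> x \<in> Q i \<Longrightarrow> y \<in> Q i \<Longrightarrow> x \<otimes> y \<in> Q i"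
    and F_eq: "\<And>i. i \<in> I \<Longrightarrow> F i = Q i \<union> H \<union> m_inv A ` Q i"
    and Q_H_disjoint: "\<And>i. i \<in> I \<Longrightarrow> Q i \<inter> H = {}"
    and Q_inv_disjoint: "\<And>i. i \<in> I \<Longrightarrow> Q i \<inter> m_inv A ` Q i = {}"
    and P_mult: "\<And>x y. x \<in> P \<Longrightarrow> y \<in> P \<Longrightarrow> x \<otimes> y \<in> P"
    and H_eq: "H = P \<union> {\<one>} \<union> m_inv A ` P"
    and one_notin_P: "\<one> \<notin> P"
    and generated: "carrier A = generate A (\<Union>i\<in>I. F i)"
    and alternating_nontrivial: "\<And>g t a b. alternating A I F H Q g t a b \<Longrightarrow> g \<noteq> \<one>"
begin

section \<open>Signs of syllables and their behaviour under multiplication\<close>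

abbreviation alt :: "'a \<Rightarrow> int \<Rightarrow> nat \<Rightarrow> nat \<Rightarrow> bool" where
  "alt \<equiv> alternating A I F H Q"

lemma F_carrier: "i \<in> I \<Longrightarrow> x \<in> F i \<Longrightarrow> x \<in> carrier A"
  using subgroup.mem_carrier[OF F_subgroup] .

lemma H_carrier: "h \<in> H \<Longrightarrow> h \<in> carrier A"
  using subgroup.mem_carrier[OF H_subgroup] .

lemma Q_subset: "i \<in> I \<Longrightarrow> x \<in> Q i \<Longrightarrow> x \<in> F i - H"
  using F_eq Q_H_disjoint by blast

lemma P_subset: "x \<in> P \<Longrightarrow> x \<in> H"
  using H_eq by blast

lemma F_minus_H_inv:
  assumes "i \<in> I" "x \<in> F i - H"
  shows "inv x \<in> F i - H"
  using assms F_subgroup H_subgroup F_carrier subgroup.m_inv_closed by (metis Diff_iff inv_inv)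

lemma F_minus_H_cases:
  assumes "i \<in> I" "x \<in> F i - H"
  obtains "x \<in> Q i" "inv x \<notin> Q i" | "inv x \<in> Q i" "x \<notin> Q i"
proof -
  have "x \<in> Q i \<or> inv x \<in> Q i"
  proof -
    have "x \<in> Q i \<union> m_inv A ` Q i" using assms F_eq[OF assms(1)] by blast
    then show ?thesis using Q_subset F_carrier assms(1) by auto
  qed
  moreover have "\<not> (x \<in> Q i \<and> inv x \<in> Q i)"
    using Q_inv_disjoint[OF assms(1)] F_carrier assms by (metis DiffD1 disjoint_iff image_eqI inv_inv)
  ultimately show ?thesis using that by blast
qed

lemma cone_sgn_inv:
  assumes "i \<in> I" "x \<in> F i - H"
  shows "cone_sgn (Q i) (inv x) = - cone_sgn (Q i) x"
  using F_minus_H_cases[OF assms] by (auto simp: cone_sgn_def)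

lemma F_minus_H_mult_right:
  assumes "i \<in> I" "x \<in> F i - H" "h \<in> H"
  shows "x \<otimes> h \<in> F i - H"
proof -
  have car: "x \<in> carrier A" "h \<in> carrier A" using assms F_carrier H_carrier by auto
  have "x \<otimes> h \<in> F i" using assms H_subset subgroup.m_closed[OF F_subgroup] by blast
  moreover have "x \<otimes> h \<notin> H"
  proof
    assume "x \<otimes> h \<in> H"
    then have "(x \<otimes> h) \<otimes> inv h \<in> H"
      using assms(3) H_subgroup subgroup.m_closed subgroup.m_inv_closed by metis
    then show False using car assms(2) by (simp add: m_assoc)
  qed
  ultimately show ?thesis by simp
qed

text \<open>Otherwise the inverse of \<open>x \<otimes> h\<close> is positive; multiplied on the
  right by the positive \<open>x\<close> it gives \<open>inv h\<close>, an element of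
  \<open>H\<close> inside \<open>Q i\<close>.\<close>

lemma Q_mult_right:
  assumes "i \<in> I" "x \<in> Q i" "h \<in> H"
  shows "x \<otimes> h \<in> Q i"
proof -
  have x: "x \<in> F i - H" using Q_subset assms by blast
  then have car: "x \<in> carrier A" "h \<in> carrier A" using assms F_carrier H_carrier by auto
  show ?thesis
  proof (rule F_minus_H_cases[OF assms(1) F_minus_H_mult_right[OF assms(1) x assms(3)]])
    assume "inv (x \<otimes> h) \<in> Q i"
    then have "inv (x \<otimes> h) \<otimes> x \<in> Q i" using Q_mult assms by blast
    then have "inv h \<in> Q i" using car by (simp add: inv_mult_group m_assoc)
    then show ?thesis
      using Q_H_disjoint[OF assms(1)] subgroup.m_inv_closed[OF H_subgroup assms(3)] by blast
  qed
qed

text \<open>\<open>Q_mult_right\<close> for \<open>h\<close> and for its inverse: the sign is a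
  function of the left coset of \<open>H\<close>.\<close>

lemma cone_sgn_mult_right:
  assumes "i \<in> I" "x \<in> F i - H" "h \<in> H"
  shows "cone_sgn (Q i) (x \<otimes> h) = cone_sgn (Q i) x"
proof -
  have car: "x \<in> carrier A" "h \<in> carrier A" using assms F_carrier H_carrier by auto
  have "x \<in> Q i" if "x \<otimes> h \<in> Q i"
    using Q_mult_right[OF assms(1) that subgroup.m_inv_closed[OF H_subgroup assms(3)]] car
    by (simp add: m_assoc)
  then show ?thesis using Q_mult_right assms unfolding cone_sgn_def by auto
qed

text \<open>Equal signs pass to the product, which then counts once instead of twice. Opposite signs
  add up to zero, and any sign of the product is off by one.\<close>

lemma cone_sgn_mult_notin:
  assumes "i \<in> I" "x \<in> F i - H" "y \<in> F i - H" "x \<otimes> y \<notin> H"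
  shows "x \<otimes> y \<in> F i - H" "\<bar>cone_sgn (Q i) (x \<otimes> y) - cone_sgn (Q i) x - cone_sgn (Q i) y\<bar> \<le> 1"
proof -
  have car: "x \<in> carrier A" "y \<in> carrier A" using assms F_carrier by auto
  show xy: "x \<otimes> y \<in> F i - H" using assms subgroup.m_closed[OF F_subgroup] by blast
  show "\<bar>cone_sgn (Q i) (x \<otimes> y) - cone_sgn (Q i) x - cone_sgn (Q i) y\<bar> \<le> 1"
  proof (cases "x \<in> Q i \<longleftrightarrow> y \<in> Q i")
    case False
    then show ?thesis by (auto simp: cone_sgn_def)
  next
    case True
    show ?thesis
    proof (cases "x \<in> Q i")
      case xQ: True
      then have "x \<otimes> y \<in> Q i" using True Q_mult assms(1) by blast
      then show ?thesis using xQ True by (simp add: cone_sgn_def)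
    next
      case xQ: False
      then have "inv x \<in> Q i" "inv y \<in> Q i"
        using True F_minus_H_cases assms(1-3) by metis+
      then have "inv (x \<otimes> y) \<in> Q i" using Q_mult assms(1) car by (simp add: inv_mult_group)
      then have "x \<otimes> y \<notin> Q i" using F_minus_H_cases[OF assms(1) xy] by metis
      then show ?thesis using xQ True by (simp add: cone_sgn_def)
    qed
  qed
qed

text \<open>Here \<open>y\<close> lies in the left coset of \<open>inv x\<close>, so it has the sign
  of \<open>inv x\<close>.\<close>

lemma cone_sgn_mult_in:
  assumes "i \<in> I" "x \<in> F i - H" "y \<in> F i - H" "x \<otimes> y \<in> H"
  shows "cone_sgn (Q i) x + cone_sgn (Q i) y = 0"
proof -
  have car: "x \<in> carrier A" "y \<in> carrier A" using assms F_carrier by auto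
  have "y = inv x \<otimes> (x \<otimes> y)" using car by (simp add: m_assoc[symmetric])
  then have "cone_sgn (Q i) y = cone_sgn (Q i) (inv x)"
    using cone_sgn_mult_right[OF assms(1) F_minus_H_inv[OF assms(1,2)] assms(4)] by simp
  then show ?thesis using cone_sgn_inv[OF assms(1,2)] by simp
qed

section \<open>Calculus of alternating products\<close>

lemmas alt_single = alternating.single[where A = A and I = I and F = F and H = H and Q = Q]

lemma alt_carrier: "alt g t a b \<Longrightarrow> g \<in> carrier A"
  by (induction rule: alternating.induct) (auto simp: F_carrier)

lemma alt_index: "alt g t a b \<Longrightarrow> a \<in> I \<and> b \<in> I"
  by (induction rule: alternating.induct) auto

lemma jump_abs: "i \<noteq> j \<Longrightarrow> jump i j = 1 \<or> jump i j = -1"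
  unfolding jump_def by (auto simp: sgn_if)

lemma jump_swap: "jump j i = - jump i j"
  unfolding jump_def by (auto simp: sgn_if)

lemma cone_sgn_abs: "cone_sgn S x = 1 \<or> cone_sgn S x = -1"
  unfolding cone_sgn_def by auto

lemma odd_cone_sgn: "odd (cone_sgn S x)"
  using cone_sgn_abs[of S x] by auto

lemma odd_jump: "i \<noteq> j \<Longrightarrow> odd (jump i j)"
  using jump_abs[of i j] by auto

lemma alt_odd: "alt g t a b \<Longrightarrow> odd t"
  by (induction rule: alternating.induct) (auto simp: odd_cone_sgn odd_jump)

text \<open>The last syllable absorbs \<open>h\<close> without leaving its left coset, so its sign
  stays.\<close>

lemma alt_mult_right:
  assumes "alt g t a b" "h \<in> H"
  shows "alt (g \<otimes> h) t a b"
  using assms(1)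
proof cases
  case single
  then show ?thesis
    using alt_single[OF _ F_minus_H_mult_right[OF _ _ assms(2)]] cone_sgn_mult_right[OF _ _ assms(2)]
    by metis
next
  case (snoc g' t' b' x)
  have "alt (g' \<otimes> (x \<otimes> h)) (t' + jump b' b + cone_sgn (Q b) (x \<otimes> h)) a b"
    using snoc by (intro alternating.snoc F_minus_H_mult_right assms(2)) auto
  moreover have "g' \<in> carrier A" "x \<in> carrier A" "h \<in> carrier A"
    using snoc alt_carrier F_carrier H_carrier assms by auto
  ultimately show ?thesis using snoc cone_sgn_mult_right[OF _ _ assms(2)] by (simp add: m_assoc)
qed

lemma alt_append:
  assumes "alt g t a b" "alt h s c d" "b \<noteq> c"
  shows "alt (g \<otimes> h) (t + jump b c + s) a d"
  using assms(2,3)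
proof (induction rule: alternating.induct)
  case (single i x)
  then show ?case using assms(1) by (intro alternating.snoc) auto
next
  case (snoc h s c d i x)
  have "g \<in> carrier A" "h \<in> carrier A" "x \<in> carrier A"
    using snoc alt_carrier assms(1) F_carrier by auto
  then show ?case
    using alternating.snoc[OF snoc.IH[OF snoc.prems] snoc.hyps(2-4)] by (simp add: m_assoc algebra_simps)
qed

lemma alt_cons:
  assumes "i \<in> I" "x \<in> F i - H" "alt h s c d" "i \<noteq> c"
  shows "alt (x \<otimes> h) (cone_sgn (Q i) x + jump i c + s) i d"
  using alt_append[OF alt_single[OF assms(1,2)] assms(3,4)] .

text \<open>Reversal turns ascents into descents, and each syllable changes its sign.\<close>

lemma alt_inv: "alt g t a b \<Longrightarrow> alt (inv g) (- t) b a"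
proof (induction rule: alternating.induct)
  case (single i x)
  then show ?case using alt_single[OF _ F_minus_H_inv] cone_sgn_inv by metis
next
  case (snoc g t a b i x)
  have "alt (inv x \<otimes> inv g) (cone_sgn (Q i) (inv x) + jump i b + - t) i a"
    using snoc by (intro alt_cons F_minus_H_inv) auto
  moreover have "g \<in> carrier A" "x \<in> carrier A"
    using snoc alt_carrier F_carrier by auto
  moreover have "cone_sgn (Q i) (inv x) + jump i b + - t = - (t + jump b i + cone_sgn (Q i) x)"
    using cone_sgn_inv[OF snoc.hyps(2,4)] jump_swap[of i b] by simp
  ultimately show ?case by (metis inv_mult_group)
qed

text \<open>Signs are known to be constant on left cosets, that is, under multiplication on the
  right; the left-hand version is reduced to it by passing to inverses.\<close>

lemma alt_mult_left:
  assumes "alt g t a b" "h \<in> H"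
  shows "alt (h \<otimes> g) t a b"
proof -
  have "alt (inv g \<otimes> inv h) (- t) b a"
    using alt_mult_right[OF alt_inv[OF assms(1)]] subgroup.m_inv_closed[OF H_subgroup assms(2)] by blast
  then have "alt (inv (inv g \<otimes> inv h)) t a b" using alt_inv by fastforce
  then show ?thesis using assms alt_carrier H_carrier by (simp add: inv_mult_group)
qed

text \<open>Alternating products grow at the right end, but in a product
  \<open>g \<otimes> h\<close> the second factor is consumed from the left.\<close>

lemma alt_uncons:
  assumes "alt h s c d"
  obtains (single) "c = d" "h \<in> F c - H" "s = cone_sgn (Q c) h"
  | (cons) y h' s' c' where "y \<in> F c - H" "c' \<noteq> c" "alt h' s' c' d" "h = y \<otimes> h'"
      "s = cone_sgn (Q c) y + jump c c' + s'"
proof -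
  have "(c = d \<and> h \<in> F c - H \<and> s = cone_sgn (Q c) h) \<or>
    (\<exists>y h' s' c'. y \<in> F c - H \<and> c' \<noteq> c \<and> alt h' s' c' d \<and> h = y \<otimes> h' \<and>
      s = cone_sgn (Q c) y + jump c c' + s')"
    using assms
  proof (induction rule: alternating.induct)
    case (single i x)
    then show ?case by blast
  next
    case (snoc g t a b i x)
    from snoc.IH show ?case
    proof (elim disjE exE conjE)
      assume "a = b" "g \<in> F a - H" "t = cone_sgn (Q a) g"
      then show ?thesis using alt_single snoc.hyps by blast
    next
      fix y h' s' c'
      assume *: "y \<in> F a - H" "c' \<noteq> a" "alt h' s' c' b" "g = y \<otimes> h'"
        "t = cone_sgn (Q a) y + jump a c' + s'"
      have "alt (h' \<otimes> x) (s' + jump b i + cone_sgn (Q i) x) c' i"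
        using * snoc.hyps by (intro alternating.snoc) auto
      moreover have "g \<otimes> x = y \<otimes> (h' \<otimes> x)"
      proof -
        have "y \<in> carrier A" using * alt_index[OF snoc.hyps(1)] F_carrier by blast
        moreover have "h' \<in> carrier A" "x \<in> carrier A" using * alt_carrier snoc.hyps F_carrier by auto
        ultimately show ?thesis using *(4) by (simp add: m_assoc)
      qed
      ultimately show ?thesis using *
        by (intro disjI2 exI[of _ y] exI[of _ "h' \<otimes> x"] exI[of _ "s' + jump b i + cone_sgn (Q i) x"] exI[of _ c'])
          (simp add: algebra_simps)
    qed
  qed
  then show ?thesis using that by blast
qed

section \<open>Weights and their defect under products\<close>

definition val :: "'a \<Rightarrow> int \<Rightarrow> bool" where
  "val g t \<longleftrightarrow> g \<in> H \<and> t = 0 \<or> (\<exists>a b. alt g t a b)"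

text \<open>If \<open>i\<close> lies between \<open>a\<close> and \<open>b\<close>, two equal jumps
  take the place of one. Otherwise the two jumps through \<open>i\<close> cancel.\<close>

lemma jump_triangle:
  "a \<noteq> b \<Longrightarrow> i \<noteq> a \<Longrightarrow> i \<noteq> b \<Longrightarrow> \<bar>jump a b - jump a i - jump i b\<bar> \<le> 1"
  unfolding jump_def by (auto simp: sgn_if)

text \<open>When the syllables at the junction cancel, two jumps are lost at once; their total error is
  bounded only because the value for \<open>b \<noteq> c\<close> is known exactly.\<close>

lemma alt_mult_alt:
  assumes "alt g t a b" "alt h s c d"
  shows "\<exists>z. val (g \<otimes> h) z \<and> (b \<noteq> c \<longrightarrow> z = t + s + jump b c) \<and> (b = c \<longrightarrow> \<bar>z - t - s\<bar> \<le> 1)"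
  using assms
proof (induction arbitrary: h s c d rule: alternating.induct)
  case (single i x)
  have xc: "x \<in> carrier A" using single F_carrier by auto
  show ?case
  proof (cases "i = c")
    case False
    then have "alt (x \<otimes> h) (cone_sgn (Q i) x + jump i c + s) i d"
      using single by (intro alt_cons) auto
    then show ?thesis using False unfolding val_def by (intro exI[of _ "cone_sgn (Q i) x + s + jump i c"]) (auto simp: algebra_simps)
  next
    case True
    from single.prems show ?thesis
    proof (cases rule: alt_uncons)
      case s: single
      show ?thesis
      proof (cases "x \<otimes> h \<in> H")
        case in_H: True
        have "cone_sgn (Q i) x + s = 0"
          using cone_sgn_mult_in[OF single.hyps(1,2) _ in_H] s True by simp
        then show ?thesis using in_H True unfolding val_def by (intro exI[of _ 0]) auto
      next
        case notin: False
        note * = cone_sgn_mult_notin[OF single.hyps(1,2) _ notin]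
        have "alt (x \<otimes> h) (cone_sgn (Q i) (x \<otimes> h)) i i"
          using *(1) s True single.hyps(1) by (intro alt_single) auto
        then show ?thesis using *(2) s True unfolding val_def
          by (intro exI[of _ "cone_sgn (Q i) (x \<otimes> h)"]) auto
      qed
    next
      case (cons y h' s' c')
      have car: "y \<in> carrier A" "h' \<in> carrier A"
        using cons alt_carrier F_carrier single.hyps(1) True by auto
      have eq: "x \<otimes> h = (x \<otimes> y) \<otimes> h'" using car xc cons by (simp add: m_assoc)
      show ?thesis
      proof (cases "x \<otimes> y \<in> H")
        case in_H: True
        have "cone_sgn (Q i) x + cone_sgn (Q i) y = 0"
          using cone_sgn_mult_in[OF single.hyps(1,2) _ in_H] cons True by simp
        moreover have "alt (x \<otimes> h) s' c' d" unfolding eq using alt_mult_left[OF cons(3) in_H] .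
        \<comment> \<open>The two signs cancel, so \<open>s'\<close> differs from the sum of the
          weights by the one lost jump.\<close>
        ultimately show ?thesis using True cons jump_abs[of c c'] unfolding val_def
          by (intro exI[of _ s']) auto
      next
        case notin: False
        note * = cone_sgn_mult_notin[OF single.hyps(1,2) _ notin]
        have "alt ((x \<otimes> y) \<otimes> h') (cone_sgn (Q i) (x \<otimes> y) + jump i c' + s') i d"
          using * cons True single.hyps(1) by (intro alt_cons) auto
        then show ?thesis using *(2) cons True unfolding val_def eq
          by (intro exI[of _ "cone_sgn (Q i) (x \<otimes> y) + jump i c' + s'"]) auto
      qed
    qed
  qed
next
  case (snoc g t a b i x)
  have car: "x \<in> carrier A" "g \<in> carrier A" using snoc F_carrier alt_carrier by auto
  have gx: "alt (g \<otimes> x) (t + jump b i + cone_sgn (Q i) x) a i"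
    using snoc by (intro alternating.snoc)
  show ?case
  proof (cases "i = c")
    case False
    then show ?thesis using alt_append[OF gx snoc.prems False] unfolding val_def
      by (intro exI[of _ "t + jump b i + cone_sgn (Q i) x + jump i c + s"]) auto
  next
    case True
    from snoc.prems show ?thesis
    proof (cases rule: alt_uncons)
      case s: single
      have hc: "h \<in> carrier A" using s F_carrier snoc.hyps True by auto
      have eq: "(g \<otimes> x) \<otimes> h = g \<otimes> (x \<otimes> h)" using car hc by (simp add: m_assoc)
      show ?thesis
      proof (cases "x \<otimes> h \<in> H")
        case in_H: True
        have "cone_sgn (Q i) x + s = 0"
          using cone_sgn_mult_in[OF snoc.hyps(2,4) _ in_H] s True by simp
        moreover have "alt ((g \<otimes> x) \<otimes> h) t a b" unfolding eq using alt_mult_right[OF snoc.hyps(1) in_H] .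
        ultimately show ?thesis using True jump_abs[of b i] snoc.hyps(3) unfolding val_def
          by (intro exI[of _ t]) auto
      next
        case notin: False
        note * = cone_sgn_mult_notin[OF snoc.hyps(2,4) _ notin]
        have "alt (g \<otimes> (x \<otimes> h)) (t + jump b i + cone_sgn (Q i) (x \<otimes> h)) a i"
          using *(1) s True snoc.hyps by (intro alternating.snoc) auto
        then show ?thesis using *(2) s True unfolding val_def eq
          by (intro exI[of _ "t + jump b i + cone_sgn (Q i) (x \<otimes> h)"]) auto
      qed
    next
      case (cons y h' s' c')
      have car': "y \<in> carrier A" "h' \<in> carrier A"
        using cons alt_carrier F_carrier snoc.hyps(2) True by auto
      show ?thesis
      proof (cases "x \<otimes> y \<in> H")
        case in_H: True
        have eq: "(g \<otimes> x) \<otimes> h = g \<otimes> ((x \<otimes> y) \<otimes> h')" using car car' cons by (simp add: m_assoc)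
        have 0: "cone_sgn (Q i) x + cone_sgn (Q i) y = 0"
          using cone_sgn_mult_in[OF snoc.hyps(2,4) _ in_H] cons True by simp
        obtain z where z: "val ((g \<otimes> x) \<otimes> h) z" "b \<noteq> c' \<Longrightarrow> z = t + s' + jump b c'"
          "b = c' \<Longrightarrow> \<bar>z - t - s'\<bar> \<le> 1"
          unfolding eq using snoc.IH[OF alt_mult_left[OF cons(3) in_H]] by blast
        \<comment> \<open>The lost jumps lead from \<open>b\<close> to \<open>i\<close> and from
          \<open>i\<close> to \<open>c'\<close>. For \<open>b = c'\<close> they are opposite and
          only the error of the induction hypothesis remains; otherwise that hypothesis is exact and
          the error is that of \<open>jump_triangle\<close>.\<close>
        have "\<bar>z - (t + jump b i + cone_sgn (Q i) x) - s\<bar> \<le> 1"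
        proof (cases "b = c'")
          case b: True
          then show ?thesis using z(3) 0 cons(5) True jump_swap[of b i] by auto
        next
          case b: False
          then show ?thesis using z(2) 0 cons(2,5) True jump_triangle[of b c' i] snoc.hyps(3) by auto
        qed
        then show ?thesis using z(1) True by blast
      next
        case notin: False
        note * = cone_sgn_mult_notin[OF snoc.hyps(2,4) _ notin]
        have eq: "(g \<otimes> x) \<otimes> h = (g \<otimes> (x \<otimes> y)) \<otimes> h'" using car car' cons by (simp add: m_assoc)
        have "alt (g \<otimes> (x \<otimes> y)) (t + jump b i + cone_sgn (Q i) (x \<otimes> y)) a i"
          using *(1) cons True snoc.hyps by (intro alternating.snoc) auto
        then have "alt ((g \<otimes> x) \<otimes> h) (t + jump b i + cone_sgn (Q i) (x \<otimes> y) + jump i c' + s') a d"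
          unfolding eq using alt_append[OF _ cons(3)] cons(2) True by metis
        then show ?thesis using *(2) cons True unfolding val_def
          by (intro exI[of _ "t + jump b i + cone_sgn (Q i) (x \<otimes> y) + jump i c' + s'"]) auto
      qed
    qed
  qed
qed

lemma val_mult_H:
  assumes "val g t" "h \<in> H"
  shows "val (g \<otimes> h) t" "val (h \<otimes> g) t"
  using assms alt_mult_right alt_mult_left subgroup.m_closed[OF H_subgroup] unfolding val_def by blast+

text \<open>Only a lower bound is retained, as closure of the cone needs no more. The loss of 1
  covers both a descent at the junction and the error of a merger.\<close>

lemma val_mult:
  assumes "val g s" "val h t"
  shows "\<exists>u. val (g \<otimes> h) u \<and> s + t - 1 \<le> u"
proof (cases "g \<in> H \<and> s = 0 \<or> h \<in> H \<and> t = 0")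
  case True
  then have "val (g \<otimes> h) (s + t)" using val_mult_H assms by auto
  then show ?thesis by (intro exI[of _ "s + t"]) simp
next
  case False
  then obtain a b c d where "alt g s a b" "alt h t c d" using assms unfolding val_def by blast
  from alt_mult_alt[OF this] obtain z where z: "val (g \<otimes> h) z" "b \<noteq> c \<longrightarrow> z = s + t + jump b c" "b = c \<longrightarrow> \<bar>z - s - t\<bar> \<le> 1"
    by blast
  then have "s + t - 1 \<le> z" using jump_abs[of b c] by (cases "b = c") auto
  then show ?thesis using z(1) by blast
qed

lemma val_inv: "val g t \<Longrightarrow> val (inv g) (- t)"
  unfolding val_def by (elim disjE exE; use alt_inv subgroup.m_inv_closed[OF H_subgroup] in force)

lemma val_exists:
  assumes "g \<in> carrier A"
  shows "\<exists>t. val g t"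
proof -
  have F: "\<exists>t. val x t" if "i \<in> I" "x \<in> F i" for i x
    using alt_single[OF that(1), of x] that(2) unfolding val_def by blast
  have "g \<in> generate A (\<Union>i\<in>I. F i)" using assms generated by simp
  then show ?thesis
  proof (induction rule: generate.induct)
    case one
    then show ?case using subgroup.one_closed[OF H_subgroup] unfolding val_def by blast
  next
    case (incl h)
    then show ?case using F by blast
  next
    case (inv h)
    then show ?case using F val_inv by blast
  next
    case (eng h1 h2)
    then show ?case using val_mult by blast
  qed
qed

lemma val_carrier: "val g t \<Longrightarrow> g \<in> carrier A"
  unfolding val_def using alt_carrier H_carrier by blast

lemma val_even: "val g t \<Longrightarrow> even t \<Longrightarrow> g \<in> H \<and> t = 0"
  unfolding val_def using alt_odd by blast

text \<open>This is where \<open>alternating_nontrivial\<close> is spent: a nonzero weight of the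
  unit could put the unit of the product group into the cone.\<close>

lemma val_one: "val \<one> t \<Longrightarrow> t = 0"
  unfolding val_def using alternating_nontrivial by blast

end

section \<open>The positive cone and its regularity\<close>

lemma rational_times_singleton:
  assumes "group A" "rational A S"
  shows "rational (A \<times>\<times> integer_group) (S \<times> {k})"
proof -
  interpret A: group A by fact
  interpret Z: group "A \<times>\<times> integer_group" by (intro DirProd_group assms group_integer_group)
  have car: "S \<subseteq> carrier A" using rational_subset_carrier[OF A.is_monoid assms(2)] .
  have "(\<lambda>x. (x, 0)) \<in> hom A (A \<times>\<times> integer_group)" by (auto simp: hom_def)
  then have "rational (A \<times>\<times> integer_group) ((\<lambda>x. (x, 0)) ` S)"
    by (rule rational_image[OF _ _ A.is_monoid assms(2)]) simp
  then have "rational (A \<times>\<times> integer_group)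
      ((\<lambda>g. g \<otimes>\<^bsub>A \<times>\<times> integer_group\<^esub> (\<one>\<^bsub>A\<^esub>, k)) ` (\<lambda>x. (x, 0)) ` S)"
    by (rule rational_mult_right[OF Z.is_monoid]) simp
  also have "(\<lambda>g. g \<otimes>\<^bsub>A \<times>\<times> integer_group\<^esub> (\<one>\<^bsub>A\<^esub>, k)) ` (\<lambda>x. (x, 0)) ` S = S \<times> {k}"
  proof -
    have "(x, 0) \<otimes>\<^bsub>A \<times>\<times> integer_group\<^esub> (\<one>\<^bsub>A\<^esub>, k) = (x, k)" if "x \<in> S" for x
      using car that by auto
    then show ?thesis unfolding image_image by auto
  qed
  finally show ?thesis .
qed

text \<open>An element of \<open>S\<close> with inverse in \<open>S\<close> would put the unit into
  \<open>S\<close>, so disjointness of the cone from its inverses comes for free.\<close>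

lemma (in group) left_order_of_cone:
  assumes "S \<subseteq> carrier G" "\<And>x y. x \<in> S \<Longrightarrow> y \<in> S \<Longrightarrow> x \<otimes> y \<in> S" "\<one> \<notin> S"
    and total: "\<And>x. x \<in> carrier G \<Longrightarrow> x = \<one> \<or> x \<in> S \<or> inv x \<in> S"
  shows "left_order G (\<lambda>a b. inv a \<otimes> b \<in> S)"
proof -
  have tr: "inv a \<otimes> c = (inv a \<otimes> b) \<otimes> (inv b \<otimes> c)" if "a \<in> carrier G" "b \<in> carrier G" "c \<in> carrier G" for a b c
  proof -
    have "b \<otimes> (inv b \<otimes> c) = c" using that by (simp add: m_assoc[symmetric])
    then show ?thesis using that by (simp add: m_assoc)
  qed
  have tot: "a = b \<or> inv a \<otimes> b \<in> S \<or> inv b \<otimes> a \<in> S" if "a \<in> carrier G" "b \<in> carrier G" for a b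
  proof -
    have "inv (inv a \<otimes> b) = inv b \<otimes> a" using that by (simp add: inv_mult_group)
    moreover have "a = b" if *: "inv a \<otimes> b = \<one>"
    proof -
      have "a \<otimes> (inv a \<otimes> b) = b" using \<open>a \<in> carrier G\<close> \<open>b \<in> carrier G\<close> by (simp add: m_assoc[symmetric])
      then show ?thesis using * \<open>a \<in> carrier G\<close> by simp
    qed
    ultimately show ?thesis using total[of "inv a \<otimes> b"] that by auto
  qed
  have inva: "inv (g \<otimes> a) \<otimes> (g \<otimes> b) = inv a \<otimes> b" if "g \<in> carrier G" "a \<in> carrier G" "b \<in> carrier G" for g a b
  proof -
    have "inv g \<otimes> (g \<otimes> b) = b" using that by (simp add: m_assoc[symmetric])
    then show ?thesis using that by (simp add: m_assoc inv_mult_group)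
  qed
  show ?thesis
    unfolding left_order_def
  proof (intro conjI ballI impI)
    show "\<not> inv a \<otimes> a \<in> S" if "a \<in> carrier G" for a using that assms(3) by simp
    show "inv a \<otimes> c \<in> S"
      if "a \<in> carrier G" "b \<in> carrier G" "c \<in> carrier G" "inv a \<otimes> b \<in> S" "inv b \<otimes> c \<in> S" for a b c
      using assms(2)[OF that(4,5)] tr[OF that(1-3)] by simp
    show "a = b \<or> inv a \<otimes> b \<in> S \<or> inv b \<otimes> a \<in> S" if "a \<in> carrier G" "b \<in> carrier G" for a b
      using tot[OF that] .
    show "inv (g \<otimes> a) \<otimes> (g \<otimes> b) \<in> S"
      if "g \<in> carrier G" "a \<in> carrier G" "b \<in> carrier G" "inv a \<otimes> b \<in> S" for g a b
      using inva[OF that(1-3)] that(4) by simp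
  qed
qed

context relatively_ordered_factors
begin

section \<open>The cone orders the product with the integers\<close>

definition cone :: "('a \<times> int) set" where
  "cone = {(g, m). \<exists>t. val g t \<and> t + 2 * m \<ge> 1} \<union> P \<times> {0}"

abbreviation AZ where "AZ \<equiv> A \<times>\<times> integer_group"

lemma group_AZ: "group AZ"
  by (intro DirProd_group group_axioms group_integer_group)

lemma cone_carrier: "cone \<subseteq> carrier AZ"
  unfolding cone_def using val_carrier P_subset H_carrier by auto

lemma cone_mult:
  assumes "x \<in> cone" "y \<in> cone"
  shows "x \<otimes>\<^bsub>AZ\<^esub> y \<in> cone"
proof -
  obtain g m h k where xy: "x = (g, m)" "y = (h, k)" by (cases x, cases y)
  from assms consider
    (a) s t where "val g s" "s + 2 * m \<ge> 1" "val h t" "t + 2 * k \<ge> 1"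
    | (b) s where "val g s" "s + 2 * m \<ge> 1" "h \<in> P" "k = 0"
    | (c) t where "g \<in> P" "m = 0" "val h t" "t + 2 * k \<ge> 1"
    | (d) "g \<in> P" "m = 0" "h \<in> P" "k = 0"
    unfolding cone_def xy by auto
  then show ?thesis
  proof cases
    case a
    \<comment> \<open>Both \<open>s + 2 * m\<close> and \<open>t + 2 * k\<close> are at least 1, so
      their sum can afford to lose 1.\<close>
    then obtain u where "val (g \<otimes> h) u" "s + t - 1 \<le> u" using val_mult by blast
    then show ?thesis using a unfolding cone_def xy by (auto intro!: exI[of _ u])
  next
    case b
    then show ?thesis using val_mult_H(1)[OF b(1) P_subset[OF b(3)]] unfolding cone_def xy by auto
  next
    case c
    then show ?thesis using val_mult_H(2)[OF c(3) P_subset[OF c(1)]] unfolding cone_def xy by auto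
  next
    case d
    then show ?thesis using P_mult unfolding cone_def xy by auto
  qed
qed

lemma one_notin_cone: "\<one>\<^bsub>AZ\<^esub> \<notin> cone"
  unfolding cone_def using one_notin_P by (auto dest: val_one)

lemma cone_total:
  assumes "x \<in> carrier AZ"
  shows "x = \<one>\<^bsub>AZ\<^esub> \<or> x \<in> cone \<or> inv\<^bsub>AZ\<^esub> x \<in> cone"
proof -
  obtain g m where x: "x = (g, m)" "g \<in> carrier A" using assms by auto
  have ix: "inv\<^bsub>AZ\<^esub> x = (inv g, - m)"
    using x by (simp add: inv_DirProd[OF group_axioms group_integer_group])
  obtain t where t: "val g t" using val_exists x(2) by blast
  \<comment> \<open>In the third case \<open>t\<close> is even, which forces \<open>g\<close> into
    \<open>H\<close> with \<open>t = 0\<close>, and then \<open>m = 0\<close>: precisely the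
    elements that \<open>P\<close> has to order.\<close>
  consider "t + 2 * m \<ge> 1" | "- t + 2 * - m \<ge> 1" | "t = 2 * - m" by linarith
  then show ?thesis
  proof cases
    case 1
    then show ?thesis using t unfolding cone_def x by auto
  next
    case 2
    then show ?thesis using val_inv[OF t] unfolding ix unfolding cone_def by blast
  next
    case 3
    then have "g \<in> H" "m = 0" using val_even[OF t] by auto
    then consider "g \<in> P" | "g = \<one>" | "inv g \<in> P"
      using H_eq P_subset H_carrier by (auto simp: inv_inv)
    then show ?thesis using \<open>m = 0\<close> unfolding ix unfolding cone_def x by cases auto
  qed
qed

lemma left_order_cone: "left_order AZ (\<lambda>a b. inv\<^bsub>AZ\<^esub> a \<otimes>\<^bsub>AZ\<^esub> b \<in> cone)"
  by (rule group.left_order_of_cone[OF group_AZ cone_carrier cone_mult one_notin_cone cone_total])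

text \<open>A single vertex suffices. Its loops carry the sets \<open>F i \<times> {0}\<close> and
  the two generators of the integers, and walks are arbitrary products of these.\<close>

lemma rational_carrier:
  assumes "\<And>i. i \<in> I \<Longrightarrow> rational A (F i)"
  shows "rational AZ (carrier AZ)"
proof -
  interpret Z: group AZ by (rule group_AZ)
  define N where "N = (\<lambda>i. ((), F i \<times> {0 :: int}, ())) ` I \<union> {((), {(\<one>, 1)}, ()), ((), {(\<one>, - 1)}, ())}"
  define E where "E = {(p, g, q). \<exists>R. (p, R, q) \<in> N \<and> g \<in> R}"
  have ratN: "rational AZ R" if "(p, R, q) \<in> N" for p R q
    using that unfolding N_def
    by (auto intro!: rational_times_singleton[OF group_axioms] rational_singleton[OF Z.is_monoid] assms)
  have "E \<subseteq> UNIV \<times> carrier AZ \<times> UNIV"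
    unfolding E_def using ratN rational_subset_carrier[OF Z.is_monoid] by blast
  note car = this
  note trans = walk_trans[OF Z.is_monoid car]
  have EF: "((), (x, 0), ()) \<in> E" if "i \<in> I" "x \<in> F i" for i x
    unfolding E_def N_def using that by auto
  have E1: "((), (\<one>, 1), ()) \<in> E" "((), (\<one>, - 1), ()) \<in> E" unfolding E_def N_def by auto
  have g0: "walk AZ E () (g, 0) ()" if "g \<in> carrier A" for g
  proof -
    have "g \<in> generate A (\<Union>i\<in>I. F i)" using that generated by simp
    then show ?thesis
    proof (induction rule: generate.induct)
      case one
      show ?case using walk.Nil[of AZ E "()"] by simp
    next
      case (incl h)
      then obtain i where "i \<in> I" "h \<in> F i" by blast
      then show ?case by (intro walk_single Z.is_monoid EF) (auto simp: F_carrier)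
    next
      case (inv h)
      then obtain i where "i \<in> I" "inv h \<in> F i" using subgroup.m_inv_closed[OF F_subgroup] by blast
      then show ?case by (intro walk_single Z.is_monoid EF) (auto simp: F_carrier)
    next
      case (eng h1 h2)
      then show ?case using trans[OF eng.IH] by simp
    qed
  qed
  have pos: "walk AZ E () (\<one>, int n) ()" for n
  proof (induction n)
    case 0
    show ?case using walk.Nil[of AZ E "()"] by simp
  next
    case (Suc n)
    then show ?case using walk.Cons[OF E1(1) Suc] by (simp add: add.commute)
  qed
  have neg: "walk AZ E () (\<one>, - int n) ()" for n
  proof (induction n)
    case 0
    show ?case using walk.Nil[of AZ E "()"] by simp
  next
    case (Suc n)
    then show ?case using walk.Cons[OF E1(2) Suc] by (simp add: add.commute)
  qed
  have "walk AZ E () (\<one>, m) ()" for m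
    using pos[of "nat m"] neg[of "nat (- m)"] by (cases "m \<ge> 0") auto
  then have "walk AZ E () (g, m) ()" if "g \<in> carrier A" for g m
    using trans[OF g0[OF that], of "(\<one>, m)" "()"] that by simp
  then have "carrier AZ \<subseteq> walks AZ E {()} {()}" by auto
  then have "carrier AZ = walks AZ E {()} {()}"
    using walks_subset_carrier[OF Z.is_monoid car] by blast
  also have "rational AZ \<dots>" unfolding E_def
    by (rule rational_substitute[OF Z.is_monoid _ _ _ ratN]) (auto simp: N_def finite_I)
  finally show ?thesis .
qed

text \<open>In the graph below, state \<open>Some (Some i)\<close> means that the last syllable read lies in \<open>F i\<close>. The
  edges emit integers which keep \<open>t + 2 * m = 1\<close>, for \<open>t\<close> the weight of the alternating
  product read so far and \<open>m\<close> the sum of the integers emitted.\<close>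

definition cone_graph :: "(nat option option \<times> ('a \<times> int) set \<times> nat option option) set" where
  "cone_graph =
     (\<lambda>i. (None, Q i \<times> {0}, Some (Some i))) ` I \<union>
     (\<lambda>i. (None, m_inv A ` Q i \<times> {1}, Some (Some i))) ` I \<union>
     (\<lambda>(i, j). (Some (Some i), Q j \<times> {- ((jump i j + 1) div 2)}, Some (Some j))) ` {(i, j). i \<in> I \<and> j \<in> I \<and> i \<noteq> j} \<union>
     (\<lambda>(i, j). (Some (Some i), m_inv A ` Q j \<times> {- ((jump i j - 1) div 2)}, Some (Some j))) ` {(i, j). i \<in> I \<and> j \<in> I \<and> i \<noteq> j} \<union>
     (\<lambda>i. (Some (Some i), {(\<one>, 0)}, Some None)) ` I \<union>
     {(None, H \<times> {1}, Some None), (Some None, {(\<one>, 1)}, Some None)}"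

definition cone_edges :: "(nat option option \<times> ('a \<times> int) \<times> nat option option) set" where
  "cone_edges = {(p, g, q). \<exists>R. (p, R, q) \<in> cone_graph \<and> g \<in> R}"

section \<open>Edges and walks of the graph\<close>

lemma F_minus_H_eq: "i \<in> I \<Longrightarrow> F i - H = Q i \<union> m_inv A ` Q i"
  using F_eq[of i] Q_subset F_minus_H_inv by blast

lemma cone_sgn_Q: "x \<in> Q i \<Longrightarrow> cone_sgn (Q i) x = 1"
  by (simp add: cone_sgn_def)

lemma cone_sgn_inv_Q: "i \<in> I \<Longrightarrow> x \<in> m_inv A ` Q i \<Longrightarrow> cone_sgn (Q i) x = - 1"
  using Q_inv_disjoint by (auto simp: cone_sgn_def)

lemma cone_edges_None:
  assumes "(None, (x, k), q) \<in> cone_edges"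
  shows "(\<exists>i\<in>I. q = Some (Some i) \<and> x \<in> F i - H \<and> cone_sgn (Q i) x + 2 * k = 1) \<or>
    (q = Some None \<and> x \<in> H \<and> k = 1)"
  using assms Q_subset F_minus_H_inv unfolding cone_edges_def cone_graph_def
  by (auto simp: cone_sgn_Q cone_sgn_inv_Q)

text \<open>A jump is 1 or -1, so the divisions by 2 in \<open>cone_graph\<close> are exact and
  twice the emitted integer cancels the jump plus the sign of the new syllable.\<close>

lemma cone_edges_syllable:
  assumes "(Some (Some i), (x, k), q) \<in> cone_edges"
  shows "(\<exists>j\<in>I. q = Some (Some j) \<and> i \<noteq> j \<and> x \<in> F j - H \<and> jump i j + cone_sgn (Q j) x + 2 * k = 0) \<or>
    (q = Some None \<and> x = \<one> \<and> k = 0)"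
proof -
  consider (1) j where "j \<in> I" "i \<noteq> j" "q = Some (Some j)" "x \<in> Q j" "k = - ((jump i j + 1) div 2)"
    | (2) j where "j \<in> I" "i \<noteq> j" "q = Some (Some j)" "x \<in> m_inv A ` Q j" "k = - ((jump i j - 1) div 2)"
    | (3) "q = Some None \<and> x = \<one> \<and> k = 0"
    using assms unfolding cone_edges_def cone_graph_def by auto
  then show ?thesis
  proof cases
    case 1
    then show ?thesis using jump_abs[of i j] Q_subset cone_sgn_Q[of x j] by auto
  next
    case 2
    then have "x \<in> F j - H" using F_minus_H_eq by blast
    then show ?thesis using 2 jump_abs[of i j] cone_sgn_inv_Q[of j x] by auto
  next
    case 3
    then show ?thesis by blast
  qed
qed

lemma cone_edges_final: "(Some None, (x, k), q) \<in> cone_edges \<Longrightarrow> q = Some None \<and> x = \<one> \<and> k = 1"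
  unfolding cone_edges_def cone_graph_def by auto

lemma edge_None:
  assumes "i \<in> I" "x \<in> F i - H" "cone_sgn (Q i) x + 2 * k = 1"
  shows "(None, (x, k), Some (Some i)) \<in> cone_edges"
proof -
  consider "x \<in> Q i" | "x \<in> m_inv A ` Q i" using assms F_minus_H_eq by blast
  then show ?thesis
  proof cases
    case 1
    then have "(x, k) \<in> Q i \<times> {0}" using assms cone_sgn_Q[OF 1] by simp
    moreover have "(None, Q i \<times> {0}, Some (Some i)) \<in> cone_graph"
      unfolding cone_graph_def using assms(1) by simp
    ultimately show ?thesis unfolding cone_edges_def by blast
  next
    case 2
    then have "(x, k) \<in> m_inv A ` Q i \<times> {1}" using assms cone_sgn_inv_Q[OF assms(1) 2] by simp
    moreover have "(None, m_inv A ` Q i \<times> {1}, Some (Some i)) \<in> cone_graph"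
      unfolding cone_graph_def using assms(1) by simp
    ultimately show ?thesis unfolding cone_edges_def by blast
  qed
qed

lemma edge_syllable:
  assumes "i \<in> I" "j \<in> I" "i \<noteq> j" "x \<in> F j - H" "jump i j + cone_sgn (Q j) x + 2 * k = 0"
  shows "(Some (Some i), (x, k), Some (Some j)) \<in> cone_edges"
proof -
  consider "x \<in> Q j" | "x \<in> m_inv A ` Q j" using assms F_minus_H_eq by blast
  then show ?thesis
  proof cases
    case 1
    then have "(x, k) \<in> Q j \<times> {- ((jump i j + 1) div 2)}" using assms(5) cone_sgn_Q[OF 1] by simp
    moreover have "(Some (Some i), Q j \<times> {- ((jump i j + 1) div 2)}, Some (Some j)) \<in> cone_graph"
      unfolding cone_graph_def using assms(1-3) by force
    ultimately show ?thesis unfolding cone_edges_def by blast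
  next
    case 2
    then have "(x, k) \<in> m_inv A ` Q j \<times> {- ((jump i j - 1) div 2)}"
      using assms(5) cone_sgn_inv_Q[OF assms(2) 2] by simp
    moreover have "(Some (Some i), m_inv A ` Q j \<times> {- ((jump i j - 1) div 2)}, Some (Some j)) \<in> cone_graph"
      unfolding cone_graph_def using assms(1-3) by force
    ultimately show ?thesis unfolding cone_edges_def by blast
  qed
qed

text \<open>The loop at the last state raises the integer and so turns the equality kept by the
  syllable states into \<open>\<ge>\<close>. Elements of \<open>H\<close> have weight 0 and start at
  1, the least \<open>m\<close> with \<open>2 * m \<ge> 1\<close>.\<close>

lemma edge_final:
  "i \<in> I \<Longrightarrow> (Some (Some i), (\<one>, 0), Some None) \<in> cone_edges"
  "h \<in> H \<Longrightarrow> (None, (h, 1), Some None) \<in> cone_edges"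
  "(Some None, (\<one>, 1), Some None) \<in> cone_edges"
  unfolding cone_edges_def cone_graph_def by auto

text \<open>The soundness invariant: what a walk from the initial state to the given state certifies
  about the element and the integer read so far.\<close>

fun reached :: "nat option option \<Rightarrow> 'a \<Rightarrow> int \<Rightarrow> bool" where
  "reached None g m \<longleftrightarrow> g = \<one> \<and> m = 0"
| "reached (Some (Some b)) g m \<longleftrightarrow> (\<exists>t a. alt g t a b \<and> t + 2 * m \<ge> 1)"
| "reached (Some None) g m \<longleftrightarrow> (\<exists>t. val g t \<and> t + 2 * m \<ge> 1)"

lemma reached_edge:
  assumes "reached p g m" "(p, (x, k), q) \<in> cone_edges"
  shows "reached q (g \<otimes> x) (m + k)"
proof (cases p)
  case None
  then have gm: "g = \<one>" "m = 0" using assms(1) by auto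
  from cone_edges_None[OF assms(2)[unfolded None]] show ?thesis
  proof (elim disjE bexE conjE)
    fix i assume i: "i \<in> I" "q = Some (Some i)" "x \<in> F i - H" "cone_sgn (Q i) x + 2 * k = 1"
    then show ?thesis using alt_single[OF i(1,3)] gm F_carrier by (auto simp: exI)
  next
    assume "q = Some None" "x \<in> H" "k = 1"
    then show ?thesis using gm H_carrier by (auto simp: val_def)
  qed
next
  case (Some p')
  show ?thesis
  proof (cases p')
    case None
    then obtain t where "val g t" "t + 2 * m \<ge> 1" using assms(1) Some by auto
    moreover have "q = Some None" "x = \<one>" "k = 1" using cone_edges_final assms(2) Some None by auto
    ultimately show ?thesis using val_carrier by (auto intro!: exI[of _ t])
  next
    case (Some i)
    then obtain t a where t: "alt g t a i" "t + 2 * m \<ge> 1" using assms(1) \<open>p = Some p'\<close> by auto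
    from cone_edges_syllable[of i x k q] assms(2) Some \<open>p = Some p'\<close>
    consider (1) j where "j \<in> I" "q = Some (Some j)" "i \<noteq> j" "x \<in> F j - H" "jump i j + cone_sgn (Q j) x + 2 * k = 0"
      | (2) "q = Some None" "x = \<one>" "k = 0" by blast
    then show ?thesis
    proof cases
      case 1
      then have "alt (g \<otimes> x) (t + jump i j + cone_sgn (Q j) x) a j"
        by (intro alternating.snoc t(1)) auto
      moreover have "(t + jump i j + cone_sgn (Q j) x) + 2 * (m + k) \<ge> 1" using 1(5) t(2)
        by (simp add: algebra_simps)
      ultimately show ?thesis unfolding 1(2) reached.simps by blast
    next
      case 2
      then show ?thesis using t alt_carrier by (auto simp: val_def)
    qed
  qed
qed

lemma cone_edges_carrier: "cone_edges \<subseteq> UNIV \<times> carrier AZ \<times> UNIV"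
proof -
  have "(x, k) \<in> carrier AZ" if e: "(p, (x, k), q) \<in> cone_edges" for p x k q
  proof -
    consider "p = None" | "p = Some None" | i where "p = Some (Some i)" by (metis option.exhaust)
    then show ?thesis
    proof cases
      case 1
      then show ?thesis using cone_edges_None[of x k q] e F_carrier H_carrier by auto
    next
      case 2
      then show ?thesis using cone_edges_final[of x k q] e by auto
    next
      case 3
      then have "(Some (Some i), (x, k), q) \<in> cone_edges" using e by simp
      from cone_edges_syllable[OF this] show ?thesis using F_carrier by auto
    qed
  qed
  then show ?thesis by (intro subsetI) (metis (no_types, lifting) UNIV_I mem_Sigma_iff prod.exhaust)
qed

lemma reached_walk:
  "walk AZ cone_edges p x q \<Longrightarrow> g \<in> carrier A \<Longrightarrow> reached p g m \<Longrightarrow> reached q (g \<otimes> fst x) (m + snd x)"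
proof (induction arbitrary: g m rule: walk.induct)
  case (Nil p)
  then show ?case by simp
next
  case (Cons p a q x r)
  obtain y k where a: "a = (y, k)" by (cases a)
  have y: "y \<in> carrier A" using Cons.hyps(1) cone_edges_carrier a by auto
  have x: "fst x \<in> carrier A"
    using walk_carrier[OF group.is_monoid[OF group_AZ] cone_edges_carrier Cons.hyps(2)] by auto
  have "reached q (g \<otimes> y) (m + k)" using reached_edge[OF Cons.prems(2)] Cons.hyps(1) a by blast
  then have "reached r ((g \<otimes> y) \<otimes> fst x) ((m + k) + snd x)"
    using y Cons.prems(1) by (intro Cons.IH) auto
  then show ?case using a x y Cons.prems(1) by (simp add: mult_DirProd' m_assoc add.assoc)
qed

lemma walk_final: "walk AZ cone_edges (Some None) (\<one>, int n) (Some None)"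
proof (induction n)
  case 0
  show ?case using walk.Nil[of AZ cone_edges "Some None"] by simp
next
  case (Suc n)
  then show ?case using walk.Cons[OF edge_final(3) Suc] by (simp add: add.commute)
qed

text \<open>Completeness of the graph for alternating products. The integer is the solution
  \<open>m\<close> of \<open>t + 2 * m = 1\<close>, which exists because weights are odd.\<close>

lemma walk_alt: "alt g t a b \<Longrightarrow> walk AZ cone_edges None (g, (1 - t) div 2) (Some (Some b))"
proof (induction rule: alternating.induct)
  case (single i x)
  have "cone_sgn (Q i) x + 2 * ((1 - cone_sgn (Q i) x) div 2) = 1" using odd_cone_sgn[of "Q i" x] by simp
  then have "(None, (x, (1 - cone_sgn (Q i) x) div 2), Some (Some i)) \<in> cone_edges"
    using single by (intro edge_None) auto
  then show ?case using single F_carrier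
    by (intro walk_single[OF group.is_monoid[OF group_AZ]]) auto
next
  case (snoc g t a b i x)
  let ?k = "- ((jump b i + cone_sgn (Q i) x) div 2)"
  have ev: "even (jump b i + cone_sgn (Q i) x)"
    using odd_cone_sgn[of "Q i" x] odd_jump[of b i] snoc.hyps by simp
  then have "(Some (Some b), (x, ?k), Some (Some i)) \<in> cone_edges"
    using snoc.hyps alt_index by (intro edge_syllable) auto
  then have "walk AZ cone_edges (Some (Some b)) (x, ?k) (Some (Some i))"
    using snoc.hyps F_carrier by (intro walk_single[OF group.is_monoid[OF group_AZ]]) auto
  from walk_trans[OF group.is_monoid[OF group_AZ] cone_edges_carrier snoc.IH this]
  have "walk AZ cone_edges None (g \<otimes> x, (1 - t) div 2 + ?k) (Some (Some i))" by simp
  moreover have "(1 - t) div 2 + ?k = (1 - (t + jump b i + cone_sgn (Q i) x)) div 2"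
    using ev alt_odd[OF snoc.hyps(1)] by presburger
  ultimately show ?case by simp
qed

lemma cone_eq_walks: "cone = walks AZ cone_edges {None} {Some None} \<union> P \<times> {0}"
proof -
  note trans = walk_trans[OF group.is_monoid[OF group_AZ] cone_edges_carrier]
  note single = walk_single[OF group.is_monoid[OF group_AZ]]
  have "walk AZ cone_edges None (g, m) (Some None) \<longleftrightarrow> (\<exists>t. val g t \<and> t + 2 * m \<ge> 1)" for g m
  proof
    assume w: "walk AZ cone_edges None (g, m) (Some None)"
    then have "g \<in> carrier A"
      using walk_carrier[OF group.is_monoid[OF group_AZ] cone_edges_carrier w] by auto
    then show "\<exists>t. val g t \<and> t + 2 * m \<ge> 1" using reached_walk[OF w, of \<one> 0] by auto
  next
    assume "\<exists>t. val g t \<and> t + 2 * m \<ge> 1"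
    then obtain t where t: "val g t" "t + 2 * m \<ge> 1" by blast
    then have g: "g \<in> carrier A" using val_carrier by blast
    from t(1) consider "g \<in> H" "t = 0" | a b where "alt g t a b" unfolding val_def by blast
    then show "walk AZ cone_edges None (g, m) (Some None)"
    proof cases
      case 1
      then have "walk AZ cone_edges None (g, 1) (Some None)" using g by (intro single edge_final) auto
      from trans[OF this walk_final[of "nat (m - 1)"]] show ?thesis using g 1 t(2) by simp
    next
      case 2
      have "walk AZ cone_edges (Some (Some b)) (\<one>, 0) (Some None)"
        using alt_index[OF 2] by (intro single edge_final) auto
      \<comment> \<open>The walk for the syllables ends at the least admissible integer; the loop at
        the last state supplies the remaining difference to \<open>m\<close>.\<close>
      from trans[OF trans[OF walk_alt[OF 2] this] walk_final[of "nat (m - (1 - t) div 2)"]]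
      have "walk AZ cone_edges None (g, (1 - t) div 2 + int (nat (m - (1 - t) div 2))) (Some None)"
        using g by simp
      moreover have "(1 - t) div 2 \<le> m" using t(2) by linarith
      ultimately show ?thesis by simp
    qed
  qed
  then show ?thesis unfolding cone_def walks_single by auto
qed

lemma rational_cone:
  assumes "\<And>i. i \<in> I \<Longrightarrow> rational A (Q i)" "rational A P"
  shows "rational AZ cone"
proof -
  interpret Z: group AZ by (rule group_AZ)
  have "rational A H" unfolding H_eq
    using assms(2) by (intro rational_union rational_inverse rational_singleton is_monoid group_axioms) auto
  then have ratN: "rational AZ R" if "(p, R, q) \<in> cone_graph" for p R q
    using that unfolding cone_graph_def
    by (auto intro!: rational_times_singleton[OF group_axioms] rational_singleton[OF Z.is_monoid]
        rational_inverse[OF group_axioms] assms)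
  have "finite {(i, j). i \<in> I \<and> j \<in> I \<and> i \<noteq> j}"
    by (rule finite_subset[of _ "I \<times> I"]) (auto simp: finite_I)
  then have "finite cone_graph" unfolding cone_graph_def using finite_I by simp
  then have "rational AZ (walks AZ cone_edges {None} {Some None})"
    unfolding cone_edges_def by (rule rational_substitute[OF Z.is_monoid _ _ _ ratN]) auto
  then show ?thesis unfolding cone_eq_walks
    by (intro rational_union Z.is_monoid rational_times_singleton[OF group_axioms] assms)
qed

lemma regular_left_order_exists:
  assumes "\<And>i. i \<in> I \<Longrightarrow> rational A (F i)" "\<And>i. i \<in> I \<Longrightarrow> rational A (Q i)" "rational A P"
  shows "\<exists>R. regular_left_order AZ R"
proof -
  interpret Z: group AZ by (rule group_AZ)
  have "inv\<^bsub>AZ\<^esub> \<one>\<^bsub>AZ\<^esub> \<otimes>\<^bsub>AZ\<^esub> g = g" if "g \<in> carrier AZ" for g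
    using that by (simp only: Z.inv_one Z.l_one)
  then have eq: "{g \<in> carrier AZ. inv\<^bsub>AZ\<^esub> \<one>\<^bsub>AZ\<^esub> \<otimes>\<^bsub>AZ\<^esub> g \<in> cone} = cone"
    using cone_carrier by (intro equalityI subsetI CollectI conjI) (auto simp only: mem_Collect_eq subset_iff)
  have reg: "regular_set AZ cone"
    by (rule rational_imp_regular_set[OF Z.is_monoid rational_cone rational_carrier]) (use assms in auto)
  show ?thesis unfolding regular_left_order_def
  proof (intro exI conjI)
    show "left_order AZ (\<lambda>a b. inv\<^bsub>AZ\<^esub> a \<otimes>\<^bsub>AZ\<^esub> b \<in> cone)" by (rule left_order_cone)
    show "regular_set AZ {g \<in> carrier AZ. inv\<^bsub>AZ\<^esub> \<one>\<^bsub>AZ\<^esub> \<otimes>\<^bsub>AZ\<^esub> g \<in> cone}"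
      unfolding eq by (rule reg)
  qed
qed

end

section \<open>Normal forms in the amalgamated product\<close>

locale amalgam =
  fixes n :: nat and G :: "nat \<Rightarrow> 'a monoid" and C :: "'c monoid" and \<iota> :: "nat \<Rightarrow> 'c \<Rightarrow> 'a"
  assumes factor_group: "\<And>i. i \<in> {1..n} \<Longrightarrow> group (G i)"
    and C_group: "group C"
    and iota_hom: "\<And>i. i \<in> {1..n} \<Longrightarrow> \<iota> i \<in> hom C (G i)"
    and iota_inj: "\<And>i. i \<in> {1..n} \<Longrightarrow> inj_on (\<iota> i) (carrier C)"
begin

abbreviation letters :: "(nat \<times> 'a) set" where "letters \<equiv> amal_letters n G"
abbreviation eqv :: "(nat \<times> 'a) list \<Rightarrow> (nat \<times> 'a) list \<Rightarrow> bool" where "eqv \<equiv> amal_eq n G C \<iota>"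
abbreviation cls :: "(nat \<times> 'a) list \<Rightarrow> (nat \<times> 'a) list set" where "cls \<equiv> amal_class n G C \<iota>"
abbreviation amal :: "(nat \<times> 'a) list set monoid" where "amal \<equiv> amalgamated_product n G C \<iota>"

section \<open>The amalgam as a group\<close>

lemma iota_closed: "i \<in> {1..n} \<Longrightarrow> c \<in> carrier C \<Longrightarrow> \<iota> i c \<in> carrier (G i)"
  using hom_in_carrier[OF iota_hom] .

lemma iota_mult: "i \<in> {1..n} \<Longrightarrow> c \<in> carrier C \<Longrightarrow> d \<in> carrier C \<Longrightarrow> \<iota> i (c \<otimes>\<^bsub>C\<^esub> d) = \<iota> i c \<otimes>\<^bsub>G i\<^esub> \<iota> i d"
  using hom_mult[OF iota_hom] .

lemma iota_group_hom: "i \<in> {1..n} \<Longrightarrow> group_hom C (G i) (\<iota> i)"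
  using C_group factor_group iota_hom by (simp add: group_hom_def group_hom_axioms_def)

lemma iota_subgroup: "i \<in> {1..n} \<Longrightarrow> subgroup (\<iota> i ` carrier C) (G i)"
  using group_hom.img_is_subgroup[OF iota_group_hom] .

lemma eqv_lists: "eqv u v \<Longrightarrow> u \<in> lists letters \<and> v \<in> lists letters"
proof (induction rule: amal_eq.induct)
  case (mult i g h)
  then show ?case using monoid.m_closed[OF group.is_monoid[OF factor_group]] by (simp add: amal_letters_def)
next
  case (one i)
  then show ?case using monoid.one_closed[OF group.is_monoid[OF factor_group]] by (simp add: amal_letters_def)
next
  case (amal i j c)
  then show ?case using iota_closed by (simp add: amal_letters_def)
qed auto

lemma cls_eq_iff:
  assumes "u \<in> lists letters"
  shows "cls u = cls v \<longleftrightarrow> eqv u v"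
proof
  assume "cls u = cls v"
  moreover have "u \<in> cls u" using assms by (simp add: amal_class_def amal_eq.refl)
  ultimately have "eqv v u" by (simp add: amal_class_def)
  then show "eqv u v" by (rule amal_eq.sym)
next
  assume "eqv u v"
  then show "cls u = cls v" unfolding amal_class_def by (blast intro: amal_eq.trans amal_eq.sym)
qed

lemma eqv_append:
  assumes "eqv u u'" "eqv v v'"
  shows "eqv (u @ v) (u' @ v')"
proof -
  have "eqv ([] @ u @ v) ([] @ u' @ v)" using eqv_lists assms by (intro amal_eq.ctx) auto
  moreover have "eqv (u' @ v @ []) (u' @ v' @ [])" using eqv_lists assms by (intro amal_eq.ctx) auto
  ultimately show ?thesis using amal_eq.trans by fastforce
qed

lemma carrier_amal: "carrier amal = cls ` lists letters"
  by (simp add: amalgamated_product_def)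

lemma one_amal: "\<one>\<^bsub>amal\<^esub> = cls []"
  by (simp add: amalgamated_product_def)

lemma mult_cls:
  assumes "u \<in> lists letters" "v \<in> lists letters"
  shows "cls u \<otimes>\<^bsub>amal\<^esub> cls v = cls (u @ v)"
proof -
  have "(\<exists>x\<in>cls u. \<exists>y\<in>cls v. eqv (x @ y) w) \<longleftrightarrow> eqv (u @ v) w" for w
  proof
    assume "\<exists>x\<in>cls u. \<exists>y\<in>cls v. eqv (x @ y) w"
    then show "eqv (u @ v) w" unfolding amal_class_def using eqv_append amal_eq.trans by blast
  next
    assume "eqv (u @ v) w"
    then show "\<exists>x\<in>cls u. \<exists>y\<in>cls v. eqv (x @ y) w"
      using amal_eq.refl[OF assms(1)] amal_eq.refl[OF assms(2)] unfolding amal_class_def by blast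
  qed
  then show ?thesis by (simp add: amalgamated_product_def amal_class_def)
qed

lemma left_inverse_word:
  assumes "w \<in> lists letters"
  shows "\<exists>v\<in>lists letters. eqv (v @ w) []"
  using assms
proof (induction w)
  case Nil
  have "eqv [] []" by (rule amal_eq.refl) simp
  then show ?case by (intro bexI[of _ "[]"]) auto
next
  case (Cons x w)
  obtain i g where x: "x = (i, g)" by (cases x)
  with Cons have i: "i \<in> {1..n}" "g \<in> carrier (G i)" by (auto simp: amal_letters_def)
  interpret Gi: group "G i" using factor_group i by blast
  obtain v where v: "v \<in> lists letters" "eqv (v @ w) []" using Cons by auto
  have w: "w \<in> lists letters" using Cons by auto
  have inv_letter: "(i, inv\<^bsub>G i\<^esub> g) \<in> letters" using i by (simp add: amal_letters_def)
  have "eqv [(i, inv\<^bsub>G i\<^esub> g), (i, g)] [(i, inv\<^bsub>G i\<^esub> g \<otimes>\<^bsub>G i\<^esub> g)]"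
    using i by (intro amal_eq.mult) auto
  moreover have "eqv [(i, inv\<^bsub>G i\<^esub> g \<otimes>\<^bsub>G i\<^esub> g)] []" using i amal_eq.one by simp
  ultimately have "eqv [(i, inv\<^bsub>G i\<^esub> g), (i, g)] []" by (rule amal_eq.trans)
  then have "eqv (v @ [(i, inv\<^bsub>G i\<^esub> g), (i, g)] @ w) (v @ [] @ w)"
    using v(1) w by (rule amal_eq.ctx)
  then have "eqv ((v @ [(i, inv\<^bsub>G i\<^esub> g)]) @ (x # w)) []"
    using amal_eq.trans[OF _ v(2)] x by simp
  then show ?case using v(1) inv_letter by (intro bexI[of _ "v @ [(i, inv\<^bsub>G i\<^esub> g)]"]) auto
qed

lemma group_amal: "group amal"
proof (rule groupI)
  show "x \<otimes>\<^bsub>amal\<^esub> y \<in> carrier amal" if "x \<in> carrier amal" "y \<in> carrier amal" for x y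
  proof -
    obtain u v where uv: "u \<in> lists letters" "v \<in> lists letters" "x = cls u" "y = cls v"
      using \<open>x \<in> carrier amal\<close> \<open>y \<in> carrier amal\<close> unfolding carrier_amal by blast
    then have "u @ v \<in> lists letters" by simp
    then show ?thesis unfolding carrier_amal uv(3,4) mult_cls[OF uv(1,2)] by (rule imageI)
  qed
  show "\<one>\<^bsub>amal\<^esub> \<in> carrier amal" unfolding carrier_amal one_amal by auto
  show "x \<otimes>\<^bsub>amal\<^esub> y \<otimes>\<^bsub>amal\<^esub> z = x \<otimes>\<^bsub>amal\<^esub> (y \<otimes>\<^bsub>amal\<^esub> z)"
    if "x \<in> carrier amal" "y \<in> carrier amal" "z \<in> carrier amal" for x y z
  proof -
    obtain u v w where "u \<in> lists letters" "v \<in> lists letters" "w \<in> lists letters"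
      "x = cls u" "y = cls v" "z = cls w"
      using \<open>x \<in> carrier amal\<close> \<open>y \<in> carrier amal\<close> \<open>z \<in> carrier amal\<close> unfolding carrier_amal by blast
    then show ?thesis by (simp add: mult_cls)
  qed
  show "\<one>\<^bsub>amal\<^esub> \<otimes>\<^bsub>amal\<^esub> x = x" if "x \<in> carrier amal" for x
  proof -
    obtain w where "w \<in> lists letters" "x = cls w" using \<open>x \<in> carrier amal\<close> unfolding carrier_amal by blast
    then show ?thesis using mult_cls[of "[]" w] by (simp add: one_amal)
  qed
  show "\<exists>y\<in>carrier amal. y \<otimes>\<^bsub>amal\<^esub> x = \<one>\<^bsub>amal\<^esub>" if "x \<in> carrier amal" for x
  proof -
    obtain w where w: "x = cls w" "w \<in> lists letters" using \<open>x \<in> carrier amal\<close> unfolding carrier_amal by auto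
    obtain v where v: "v \<in> lists letters" "eqv (v @ w) []" using left_inverse_word[OF w(2)] by blast
    then have "cls v \<otimes>\<^bsub>amal\<^esub> x = \<one>\<^bsub>amal\<^esub>"
      unfolding one_amal using w v by (simp add: mult_cls cls_eq_iff)
    then show ?thesis using v(1) unfolding carrier_amal by blast
  qed
qed

section \<open>The factors inside the amalgam\<close>

definition of_factor :: "nat \<Rightarrow> 'a \<Rightarrow> (nat \<times> 'a) list set" where
  "of_factor i g = cls [(i, g)]"

lemma letter_iff [simp]: "(i, g) \<in> letters \<longleftrightarrow> i \<in> {1..n} \<and> g \<in> carrier (G i)"
  by (simp add: amal_letters_def)

lemma of_factor_hom: "i \<in> {1..n} \<Longrightarrow> of_factor i \<in> hom (G i) amal"
proof (rule homI)
  show "of_factor i g \<in> carrier amal" if "i \<in> {1..n}" "g \<in> carrier (G i)" for g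
    unfolding of_factor_def carrier_amal using that by (intro imageI) simp
  show "of_factor i (g \<otimes>\<^bsub>G i\<^esub> h) = of_factor i g \<otimes>\<^bsub>amal\<^esub> of_factor i h"
    if "i \<in> {1..n}" "g \<in> carrier (G i)" "h \<in> carrier (G i)" for g h
    using that amal_eq.mult[where n = n and G = G and C = C and \<iota> = \<iota>, OF that] cls_eq_iff[of "[(i, g), (i, h)]" "[(i, g \<otimes>\<^bsub>G i\<^esub> h)]"]
    by (simp add: of_factor_def mult_cls)
qed

lemma of_factor_group_hom: "i \<in> {1..n} \<Longrightarrow> group_hom (G i) amal (of_factor i)"
  using factor_group group_amal of_factor_hom by (simp add: group_hom_def group_hom_axioms_def)

lemma of_factor_iota:
  assumes "i \<in> {1..n}" "j \<in> {1..n}" "c \<in> carrier C"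
  shows "of_factor i (\<iota> i c) = of_factor j (\<iota> j c)"
  unfolding of_factor_def using assms iota_closed by (subst cls_eq_iff) (auto intro: amal_eq.amal)

lemma amal_generated: "carrier amal = generate amal (\<Union>i\<in>{1..n}. of_factor i ` carrier (G i))"
  (is "_ = generate amal ?S")
proof
  have "cls w \<in> generate amal ?S" if "w \<in> lists letters" for w
    using that
  proof (induction w)
    case Nil
    then show ?case using generate.one[of amal ?S] by (simp add: one_amal)
  next
    case (Cons x w)
    obtain i g where x: "x = (i, g)" by (cases x)
    then have "i \<in> {1..n}" "g \<in> carrier (G i)" using Cons by auto
    moreover from this have "cls (x # w) = of_factor i g \<otimes>\<^bsub>amal\<^esub> cls w"
      using Cons x by (simp add: of_factor_def mult_cls)
    moreover have "cls w \<in> generate amal ?S" using Cons by simp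
    moreover have "of_factor i g \<in> generate amal ?S" using calculation(1,2) by (intro generate.incl) blast
    ultimately show ?case by (simp only: generate.eng)
  qed
  then show "carrier amal \<subseteq> generate amal ?S" unfolding carrier_amal by auto
  have "?S \<subseteq> carrier amal" using hom_in_carrier[OF of_factor_hom] by auto
  then show "generate amal ?S \<subseteq> carrier amal"
    using group.generate_incl[OF group_amal] by blast
qed

text \<open>Van der Waerden's trick: the factors act on normal forms \<open>(c, l)\<close>, which stand for
  \<open>c\<close> followed by the product of coset representatives in \<open>l\<close>, by multiplying on the left and
  renormalising.\<close>

definition K :: "nat \<Rightarrow> 'a set" where
  "K i = \<iota> i ` carrier C"

text \<open>The choice is made from the right coset of \<open>K i\<close> through \<open>x\<close>.
  The coset \<open>K i\<close> itself is not given the unit as its representative, since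
  \<open>attach\<close> treats it separately.\<close>

definition rep :: "nat \<Rightarrow> 'a \<Rightarrow> 'a" where
  "rep i x = (SOME y. y \<in> carrier (G i) \<and> (\<exists>c\<in>carrier C. x = \<iota> i c \<otimes>\<^bsub>G i\<^esub> y))"

text \<open>For fixed \<open>i\<close>, \<open>split_off i\<close> and \<open>attach i\<close> are
  inverse bijections between states and pairs of an element of \<open>G i\<close> with a reduced
  list not headed by \<open>i\<close>. In these coordinates \<open>act\<close> is left
  multiplication on the first entry, so the relations of \<open>G i\<close> hold at once.\<close>

definition split_off :: "nat \<Rightarrow> 'c \<times> (nat \<times> 'a) list \<Rightarrow> 'a \<times> (nat \<times> 'a) list" where
  "split_off i \<omega> = (case \<omega> of (c, l) \<Rightarrow> if l \<noteq> [] \<and> fst (hd l) = i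
     then (\<iota> i c \<otimes>\<^bsub>G i\<^esub> snd (hd l), tl l) else (\<iota> i c, l))"

definition attach :: "nat \<Rightarrow> 'a \<times> (nat \<times> 'a) list \<Rightarrow> 'c \<times> (nat \<times> 'a) list" where
  "attach i \<xi> = (case \<xi> of (x, l) \<Rightarrow> if x \<in> K i
     then (THE c. c \<in> carrier C \<and> x = \<iota> i c, l)
     else (THE c. c \<in> carrier C \<and> x = \<iota> i c \<otimes>\<^bsub>G i\<^esub> rep i x, (i, rep i x) # l))"

definition act :: "nat \<times> 'a \<Rightarrow> 'c \<times> (nat \<times> 'a) list \<Rightarrow> 'c \<times> (nat \<times> 'a) list" where
  "act y \<omega> = (case split_off (fst y) \<omega> of (x, l) \<Rightarrow> attach (fst y) (snd y \<otimes>\<^bsub>G (fst y)\<^esub> x, l))"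

fun reduced :: "(nat \<times> 'a) list \<Rightarrow> bool" where
  "reduced [] \<longleftrightarrow> True"
| "reduced ((i, s) # l) \<longleftrightarrow> i \<in> {1..n} \<and> s \<in> carrier (G i) - K i \<and> rep i s = s \<and>
     (l \<noteq> [] \<longrightarrow> fst (hd l) \<noteq> i) \<and> reduced l"

definition states :: "('c \<times> (nat \<times> 'a) list) set" where
  "states = carrier C \<times> Collect reduced"

definition not_headed :: "nat \<Rightarrow> (nat \<times> 'a) list \<Rightarrow> bool" where
  "not_headed i l \<longleftrightarrow> l = [] \<or> fst (hd l) \<noteq> i"

section \<open>The action on normal forms\<close>

lemma K_subgroup: "i \<in> {1..n} \<Longrightarrow> subgroup (K i) (G i)"
  unfolding K_def by (rule iota_subgroup)

lemma rep:
  assumes "i \<in> {1..n}" "x \<in> carrier (G i)"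
  shows "rep i x \<in> carrier (G i)" "\<exists>c\<in>carrier C. x = \<iota> i c \<otimes>\<^bsub>G i\<^esub> rep i x"
proof -
  interpret Gi: group "G i" using factor_group assms by blast
  interpret h: group_hom C "G i" "\<iota> i" using iota_group_hom assms by blast
  have "x \<in> carrier (G i) \<and> (\<exists>c\<in>carrier C. x = \<iota> i c \<otimes>\<^bsub>G i\<^esub> x)"
    using assms by (auto intro!: bexI[of _ "\<one>\<^bsub>C\<^esub>"])
  then have "rep i x \<in> carrier (G i) \<and> (\<exists>c\<in>carrier C. x = \<iota> i c \<otimes>\<^bsub>G i\<^esub> rep i x)"
    unfolding rep_def by (rule someI)
  then show "rep i x \<in> carrier (G i)" "\<exists>c\<in>carrier C. x = \<iota> i c \<otimes>\<^bsub>G i\<^esub> rep i x" by auto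
qed

text \<open>The predicates that define the two choices are equivalent, so the chosen elements are
  literally the same.\<close>

lemma rep_coset:
  assumes "i \<in> {1..n}" "x \<in> carrier (G i)" "d \<in> carrier C"
  shows "rep i (\<iota> i d \<otimes>\<^bsub>G i\<^esub> x) = rep i x"
proof -
  interpret Gi: group "G i" using factor_group assms by blast
  interpret h: group_hom C "G i" "\<iota> i" using iota_group_hom assms by blast
  have "(\<exists>c\<in>carrier C. \<iota> i d \<otimes>\<^bsub>G i\<^esub> x = \<iota> i c \<otimes>\<^bsub>G i\<^esub> y) \<longleftrightarrow> (\<exists>c\<in>carrier C. x = \<iota> i c \<otimes>\<^bsub>G i\<^esub> y)"
    if y: "y \<in> carrier (G i)" for y
  proof
    assume "\<exists>c\<in>carrier C. \<iota> i d \<otimes>\<^bsub>G i\<^esub> x = \<iota> i c \<otimes>\<^bsub>G i\<^esub> y"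
    then obtain c where c: "c \<in> carrier C" "\<iota> i d \<otimes>\<^bsub>G i\<^esub> x = \<iota> i c \<otimes>\<^bsub>G i\<^esub> y" by blast
    then have "x = inv\<^bsub>G i\<^esub> (\<iota> i d) \<otimes>\<^bsub>G i\<^esub> (\<iota> i c \<otimes>\<^bsub>G i\<^esub> y)"
      using assms y by (metis Gi.inv_solve_left Gi.m_closed h.hom_closed)
    also have "\<dots> = \<iota> i (inv\<^bsub>C\<^esub> d \<otimes>\<^bsub>C\<^esub> c) \<otimes>\<^bsub>G i\<^esub> y"
      using assms c y by (simp add: Gi.m_assoc)
    finally show "\<exists>c\<in>carrier C. x = \<iota> i c \<otimes>\<^bsub>G i\<^esub> y"
      using assms c by (intro bexI[of _ "inv\<^bsub>C\<^esub> d \<otimes>\<^bsub>C\<^esub> c"]) auto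
  next
    assume "\<exists>c\<in>carrier C. x = \<iota> i c \<otimes>\<^bsub>G i\<^esub> y"
    then obtain c where "c \<in> carrier C" "x = \<iota> i c \<otimes>\<^bsub>G i\<^esub> y" by blast
    then show "\<exists>c\<in>carrier C. \<iota> i d \<otimes>\<^bsub>G i\<^esub> x = \<iota> i c \<otimes>\<^bsub>G i\<^esub> y"
      using assms y by (intro bexI[of _ "d \<otimes>\<^bsub>C\<^esub> c"]) (auto simp: Gi.m_assoc)
  qed
  then show ?thesis unfolding rep_def by (metis (no_types, lifting))
qed

lemma mult_K_iff:
  assumes "i \<in> {1..n}" "x \<in> carrier (G i)" "d \<in> carrier C"
  shows "\<iota> i d \<otimes>\<^bsub>G i\<^esub> x \<in> K i \<longleftrightarrow> x \<in> K i" "x \<otimes>\<^bsub>G i\<^esub> \<iota> i d \<in> K i \<longleftrightarrow> x \<in> K i"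
proof -
  interpret Gi: group "G i" using factor_group assms by blast
  have d: "\<iota> i d \<in> K i" using assms unfolding K_def by blast
  note sub = K_subgroup[OF assms(1)]
  note [simp] = iota_closed[OF assms(1,3)] assms(2)
  have "inv\<^bsub>G i\<^esub> (\<iota> i d) \<otimes>\<^bsub>G i\<^esub> (\<iota> i d \<otimes>\<^bsub>G i\<^esub> x) = x" by (simp add: Gi.m_assoc[symmetric])
  then show "\<iota> i d \<otimes>\<^bsub>G i\<^esub> x \<in> K i \<longleftrightarrow> x \<in> K i"
    using subgroup.m_closed[OF sub] subgroup.m_inv_closed[OF sub] d by metis
  have "(x \<otimes>\<^bsub>G i\<^esub> \<iota> i d) \<otimes>\<^bsub>G i\<^esub> inv\<^bsub>G i\<^esub> (\<iota> i d) = x" by (simp add: Gi.m_assoc)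
  then show "x \<otimes>\<^bsub>G i\<^esub> \<iota> i d \<in> K i \<longleftrightarrow> x \<in> K i"
    using subgroup.m_closed[OF sub] subgroup.m_inv_closed[OF sub] d by metis
qed

lemma rep_idem:
  assumes "i \<in> {1..n}" "x \<in> carrier (G i)"
  shows "rep i (rep i x) = rep i x" "rep i x \<in> K i \<longleftrightarrow> x \<in> K i"
  using rep[OF assms] rep_coset[OF assms(1)] mult_K_iff(1)[OF assms(1)] by metis+

lemma attach_in:
  assumes "i \<in> {1..n}" "c \<in> carrier C"
  shows "attach i (\<iota> i c, l) = (c, l)"
proof -
  have "(THE c'. c' \<in> carrier C \<and> \<iota> i c = \<iota> i c') = c"
    using assms inj_onD[OF iota_inj[OF assms(1)]] by (intro the_equality) auto
  then show ?thesis using assms unfolding attach_def K_def by simp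
qed

lemma attach_notin:
  assumes "i \<in> {1..n}" "x \<in> carrier (G i)" "x \<notin> K i" "c \<in> carrier C"
  shows "attach i (\<iota> i c \<otimes>\<^bsub>G i\<^esub> rep i x, l) = (c, (i, rep i x) # l)"
proof -
  interpret Gi: group "G i" using factor_group assms by blast
  have r: "rep i x \<in> carrier (G i)" "rep i x \<notin> K i" using rep rep_idem assms by auto
  then have rr: "rep i (\<iota> i c \<otimes>\<^bsub>G i\<^esub> rep i x) = rep i x"
    using rep_coset[OF assms(1) r(1) assms(4)] rep_idem[OF assms(1,2)] by simp
  have "(THE c'. c' \<in> carrier C \<and> \<iota> i c \<otimes>\<^bsub>G i\<^esub> rep i x = \<iota> i c' \<otimes>\<^bsub>G i\<^esub> rep i x) = c"
    using assms r inj_onD[OF iota_inj[OF assms(1)]] iota_closed[OF assms(1)]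
    by (intro the_equality) auto
  then show ?thesis using mult_K_iff(1)[OF assms(1) r(1) assms(4)] r(2) unfolding attach_def by (simp add: rr)
qed

lemma attach_cases:
  assumes "i \<in> {1..n}" "x \<in> carrier (G i)"
  obtains (in_K) c where "c \<in> carrier C" "x = \<iota> i c" "\<And>l. attach i (x, l) = (c, l)"
  | (notin_K) c where "c \<in> carrier C" "x \<notin> K i" "x = \<iota> i c \<otimes>\<^bsub>G i\<^esub> rep i x"
      "\<And>l. attach i (x, l) = (c, (i, rep i x) # l)"
proof (cases "x \<in> K i")
  case True
  then obtain c where "c \<in> carrier C" "x = \<iota> i c" unfolding K_def by blast
  then show ?thesis using in_K attach_in assms(1) by blast
next
  case False
  obtain c where c: "c \<in> carrier C" "x = \<iota> i c \<otimes>\<^bsub>G i\<^esub> rep i x" using rep(2)[OF assms] by blast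
  then have "attach i (x, l) = (c, (i, rep i x) # l)" for l using attach_notin[OF assms False c(1)] by metis
  then show ?thesis using notin_K c False by blast
qed

lemma split_off_attach:
  assumes "i \<in> {1..n}" "x \<in> carrier (G i)" "not_headed i l"
  shows "split_off i (attach i (x, l)) = (x, l)"
  using assms(1,2) by (cases rule: attach_cases) (use assms(3) in \<open>auto simp: split_off_def not_headed_def\<close>)

lemma attach_state:
  assumes "i \<in> {1..n}" "x \<in> carrier (G i)" "not_headed i l" "reduced l"
  shows "attach i (x, l) \<in> states"
  using assms(1,2)
  by (cases rule: attach_cases)
    (use assms(3,4) rep_idem[OF assms(1,2)] rep[OF assms(1,2)] assms(1) in \<open>auto simp: states_def not_headed_def\<close>)

lemma split_off_state:
  assumes "i \<in> {1..n}" "(c, l) \<in> states"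
  obtains x l' where "split_off i (c, l) = (x, l')" "x \<in> carrier (G i)" "not_headed i l'" "reduced l'"
    "attach i (x, l') = (c, l)"
proof (cases "not_headed i l")
  case True
  then have "split_off i (c, l) = (\<iota> i c, l)" unfolding split_off_def not_headed_def by auto
  then show ?thesis using that True assms iota_closed[OF assms(1)] attach_in[OF assms(1)]
    unfolding states_def by auto
next
  case False
  interpret Gi: group "G i" using factor_group assms by blast
  obtain s l' where l: "l = (i, s) # l'" using False unfolding not_headed_def by (cases l) auto
  then have s: "s \<in> carrier (G i)" "s \<notin> K i" "rep i s = s" "not_headed i l'" "reduced l'" "c \<in> carrier C"
    using assms(2) unfolding states_def not_headed_def by auto
  show ?thesis
  proof (rule that)
    show "split_off i (c, l) = (\<iota> i c \<otimes>\<^bsub>G i\<^esub> s, l')" unfolding l split_off_def by simp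
    show "\<iota> i c \<otimes>\<^bsub>G i\<^esub> s \<in> carrier (G i)" using s iota_closed[OF assms(1)] by simp
    show "attach i (\<iota> i c \<otimes>\<^bsub>G i\<^esub> s, l') = (c, l)"
      using attach_notin[OF assms(1) s(1,2,6)] s(3) l by simp
  qed (use s in auto)
qed

lemma act_state:
  assumes "i \<in> {1..n}" "g \<in> carrier (G i)" "\<omega> \<in> states"
  shows "act (i, g) \<omega> \<in> states"
proof -
  interpret Gi: group "G i" using factor_group assms by blast
  obtain c l where \<omega>: "\<omega> = (c, l)" by (cases \<omega>)
  obtain x l' where "split_off i (c, l) = (x, l')" "x \<in> carrier (G i)" "not_headed i l'" "reduced l'"
    using split_off_state assms \<omega> by metis
  then show ?thesis using attach_state[OF assms(1)] assms(2) \<omega> unfolding act_def by simp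
qed

lemma act_mult:
  assumes "i \<in> {1..n}" "g \<in> carrier (G i)" "h \<in> carrier (G i)" "\<omega> \<in> states"
  shows "act (i, g) (act (i, h) \<omega>) = act (i, g \<otimes>\<^bsub>G i\<^esub> h) \<omega>"
proof -
  interpret Gi: group "G i" using factor_group assms by blast
  obtain c l where \<omega>: "\<omega> = (c, l)" by (cases \<omega>)
  obtain x l' where x: "split_off i (c, l) = (x, l')" "x \<in> carrier (G i)" "not_headed i l'"
    using split_off_state assms \<omega> by metis
  then have "split_off i (act (i, h) \<omega>) = (h \<otimes>\<^bsub>G i\<^esub> x, l')"
    unfolding act_def using \<omega> assms by (simp add: split_off_attach)
  then show ?thesis using x \<omega> assms by (simp add: act_def Gi.m_assoc)
qed

lemma act_one:
  assumes "i \<in> {1..n}" "\<omega> \<in> states"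
  shows "act (i, \<one>\<^bsub>G i\<^esub>) \<omega> = \<omega>"
proof -
  interpret Gi: group "G i" using factor_group assms by blast
  obtain c l where \<omega>: "\<omega> = (c, l)" by (cases \<omega>)
  obtain x l' where "split_off i (c, l) = (x, l')" "x \<in> carrier (G i)" "attach i (x, l') = (c, l)"
    using split_off_state assms \<omega> by metis
  then show ?thesis using \<omega> by (simp add: act_def)
qed

text \<open>The result does not mention \<open>i\<close>: \<open>C\<close> acts in the same way
  through every factor, which is what the amalgamation relation demands.\<close>

lemma act_iota:
  assumes "i \<in> {1..n}" "d \<in> carrier C" "(c, l) \<in> states"
  shows "act (i, \<iota> i d) (c, l) = (d \<otimes>\<^bsub>C\<^esub> c, l)"
proof -
  interpret Gi: group "G i" using factor_group assms by blast
  interpret C: group C by (rule C_group)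
  have c: "c \<in> carrier C" using assms(3) unfolding states_def by simp
  note [simp] = iota_closed[OF assms(1)]
  show ?thesis
  proof (cases "not_headed i l")
    case True
    then have "split_off i (c, l) = (\<iota> i c, l)" unfolding split_off_def not_headed_def by auto
    then show ?thesis
      using attach_in[OF assms(1) C.m_closed[OF assms(2) c]] iota_mult[OF assms(1,2) c] by (simp add: act_def)
  next
    case False
    obtain s l' where l: "l = (i, s) # l'" using False unfolding not_headed_def by (cases l) auto
    then have s: "s \<in> carrier (G i)" "s \<notin> K i" "rep i s = s"
      using assms(3) unfolding states_def by auto
    have "split_off i (c, l) = (\<iota> i c \<otimes>\<^bsub>G i\<^esub> s, l')" unfolding l split_off_def by simp
    moreover have "\<iota> i d \<otimes>\<^bsub>G i\<^esub> (\<iota> i c \<otimes>\<^bsub>G i\<^esub> s) = \<iota> i (d \<otimes>\<^bsub>C\<^esub> c) \<otimes>\<^bsub>G i\<^esub> rep i s"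
      using s assms(2) c iota_mult[OF assms(1,2) c] by (simp add: Gi.m_assoc)
    ultimately show ?thesis
      using attach_notin[OF assms(1) s(1,2) C.m_closed[OF assms(2) c]] s(3) l by (simp add: act_def)
  qed
qed

lemma acts_state: "w \<in> lists letters \<Longrightarrow> \<omega> \<in> states \<Longrightarrow> foldr act w \<omega> \<in> states"
  by (induction w) (auto simp: act_state)

text \<open>The action passes from words to the amalgam. It is used to tell classes apart: words
  with different effects on some state are not congruent.\<close>

lemma eqv_acts: "eqv u v \<Longrightarrow> \<omega> \<in> states \<Longrightarrow> foldr act u \<omega> = foldr act v \<omega>"
proof (induction arbitrary: \<omega> rule: amal_eq.induct)
  case (ctx u v a b)
  then show ?case using acts_state by simp
next
  case (mult i g h)
  then show ?case by (simp add: act_mult)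
next
  case (one i)
  then show ?case by (simp add: act_one)
next
  case (amal i j c)
  then show ?case using act_iota by (cases \<omega>) auto
qed auto

section \<open>Consequences of the action: embedded factors and nontrivial products\<close>

lemma base_state: "(\<one>\<^bsub>C\<^esub>, []) \<in> states"
  unfolding states_def using monoid.one_closed[OF group.is_monoid[OF C_group]] by simp

text \<open>No syllable of \<open>l\<close> is merged, and \<open>g\<close> stays outside
  \<open>K i\<close> after absorbing the image of \<open>c\<close>, so \<open>attach\<close> has to
  prepend a new syllable.\<close>

lemma act_notin:
  assumes "i \<in> {1..n}" "g \<in> carrier (G i)" "g \<notin> K i" "(c, l) \<in> states" "not_headed i l"
  shows "\<exists>c' s. act (i, g) (c, l) = (c', (i, s) # l)"
proof -
  interpret Gi: group "G i" using factor_group assms by blast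
  have c: "c \<in> carrier C" using assms(4) unfolding states_def by simp
  have "split_off i (c, l) = (\<iota> i c, l)" using assms(5) unfolding split_off_def not_headed_def by auto
  moreover have "g \<otimes>\<^bsub>G i\<^esub> \<iota> i c \<in> carrier (G i)" "g \<otimes>\<^bsub>G i\<^esub> \<iota> i c \<notin> K i"
    using assms c mult_K_iff(2)[OF assms(1,2) c] iota_closed[OF assms(1) c] by auto
  ultimately show ?thesis
    using attach_cases[OF assms(1), of "g \<otimes>\<^bsub>G i\<^esub> \<iota> i c"] c unfolding act_def K_def
    by (metis (no_types, lifting) case_prod_conv fst_conv snd_conv image_eqI)
qed

text \<open>An element of \<open>G i\<close> can be read off from its action on the base state by
  \<open>split_off i\<close>.\<close>

lemma of_factor_inj_on: "i \<in> {1..n} \<Longrightarrow> inj_on (of_factor i) (carrier (G i))"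
proof (rule inj_onI)
  fix g h assume i: "i \<in> {1..n}" and gh: "g \<in> carrier (G i)" "h \<in> carrier (G i)" "of_factor i g = of_factor i h"
  interpret Gi: group "G i" using factor_group i by blast
  interpret h: group_hom C "G i" "\<iota> i" using iota_group_hom i by blast
  have "eqv [(i, g)] [(i, h)]" using cls_eq_iff[of "[(i, g)]" "[(i, h)]"] gh i unfolding of_factor_def by simp
  from eqv_acts[OF this base_state] have "act (i, g) (\<one>\<^bsub>C\<^esub>, []) = act (i, h) (\<one>\<^bsub>C\<^esub>, [])" by simp
  moreover have "split_off i (act (i, x) (\<one>\<^bsub>C\<^esub>, [])) = (x, [])" if "x \<in> carrier (G i)" for x
    unfolding act_def using split_off_attach[OF i that, of "[]"] that
    by (simp add: split_off_def[of i "(\<one>\<^bsub>C\<^esub>, [])"] not_headed_def)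
  ultimately show "g = h" using gh by (metis prod.inject)
qed

lemma of_factor_iota_eq_one:
  assumes "i \<in> {1..n}" "c \<in> carrier C" "of_factor i (\<iota> i c) = \<one>\<^bsub>amal\<^esub>"
  shows "c = \<one>\<^bsub>C\<^esub>"
proof -
  interpret C: group C by (rule C_group)
  have "eqv [(i, \<iota> i c)] []"
    using cls_eq_iff[of "[(i, \<iota> i c)]" "[]"] assms iota_closed[OF assms(1,2)] unfolding of_factor_def one_amal by simp
  from eqv_acts[OF this base_state] show ?thesis using act_iota[OF assms(1,2) base_state] assms(2) by simp
qed

text \<open>The word acts from its right end: the last index \<open>b\<close> decides which states
  are safe, and the first index \<open>a\<close> heads the result. The claim covers all states not
  headed by \<open>b\<close>, because in the induction step the new last syllable has already acted
  on the state.\<close>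

lemma alternating_acts:
  assumes "alternating amal {1..n} (\<lambda>i. of_factor i ` carrier (G i)) H Q g t a b"
    and H: "\<And>i. i \<in> {1..n} \<Longrightarrow> of_factor i ` K i \<subseteq> H"
  shows "\<exists>w\<in>lists letters. g = cls w \<and>
    (\<forall>c l. (c, l) \<in> states \<longrightarrow> not_headed b l \<longrightarrow> (\<exists>c' s l'. foldr act w (c, l) = (c', (a, s) # l')))"
  using assms(1)
proof (induction rule: alternating.induct)
  case (single i x)
  then obtain g where g: "g \<in> carrier (G i)" "g \<notin> K i" "x = of_factor i g" using H by blast
  then show ?case using act_notin[OF single(1) g(1,2)] single(1)
    by (intro bexI[of _ "[(i, g)]"]) (fastforce simp: of_factor_def)+
next
  case (snoc g t a b i x)
  then obtain y where y: "y \<in> carrier (G i)" "y \<notin> K i" "x = of_factor i y" using H by blast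
  obtain w where w: "w \<in> lists letters" "g = cls w"
    "\<And>c l. (c, l) \<in> states \<Longrightarrow> not_headed b l \<Longrightarrow> \<exists>c' s l'. foldr act w (c, l) = (c', (a, s) # l')"
    using snoc.IH by blast
  have "\<exists>c' s l'. foldr act (w @ [(i, y)]) (c, l) = (c', (a, s) # l')"
    if cl: "(c, l) \<in> states" "not_headed i l" for c l
  proof -
    obtain c' s where c': "act (i, y) (c, l) = (c', (i, s) # l)"
      using act_notin[OF snoc.hyps(2) y(1,2) cl] by blast
    moreover have "(c', (i, s) # l) \<in> states" using act_state[OF snoc.hyps(2) y(1) cl(1)] c' by simp
    moreover have "not_headed b ((i, s) # l)" using snoc.hyps(3) by (simp add: not_headed_def)
    ultimately show ?thesis using w(3) by simp
  qed
  moreover have "g \<otimes>\<^bsub>amal\<^esub> x = cls (w @ [(i, y)])"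
    using w y snoc.hyps(2) by (simp add: of_factor_def mult_cls)
  ultimately show ?case using w(1) y(1) snoc.hyps(2) by (intro bexI[of _ "w @ [(i, y)]"]) auto
qed

text \<open>The empty word fixes the base state, whose list is empty, whereas an alternating product
  sends it to a state with a nonempty list.\<close>

lemma alternating_neq_one:
  assumes "alternating amal {1..n} (\<lambda>i. of_factor i ` carrier (G i)) H Q g t a b"
    and "\<And>i. i \<in> {1..n} \<Longrightarrow> of_factor i ` K i \<subseteq> H"
  shows "g \<noteq> \<one>\<^bsub>amal\<^esub>"
proof
  assume "g = \<one>\<^bsub>amal\<^esub>"
  obtain w where w: "w \<in> lists letters" "g = cls w"
    "\<forall>c l. (c, l) \<in> states \<longrightarrow> not_headed b l \<longrightarrow> (\<exists>c' s l'. foldr act w (c, l) = (c', (a, s) # l'))"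
    using alternating_acts[OF assms] by blast
  have "cls w = cls []" using w(2) \<open>g = \<one>\<^bsub>amal\<^esub>\<close> one_amal by simp
  then have "eqv w []" using cls_eq_iff[OF w(1)] by blast
  from eqv_acts[OF this base_state] w(3) base_state show False by (fastforce simp: not_headed_def)
qed

section \<open>The amalgam as a group with relatively ordered factors\<close>

lemma of_factor_K:
  assumes "i \<in> {1..n}" "j \<in> {1..n}"
  shows "of_factor i ` K i = of_factor j ` K j"
  unfolding K_def image_image using of_factor_iota[OF assms] by simp

text \<open>\<open>C\<close> is placed in the amalgam through one chosen factor \<open>k\<close>; by
  \<open>of_factor_K\<close> the choice does not affect the image. Disjointness survives the passage
  to images by injectivity of \<open>of_factor\<close>.\<close>

lemma amal_ordered_factors:
  assumes k: "k \<in> {1..n}" and Q: "\<And>i. i \<in> {1..n} \<Longrightarrow> rel_pos_cone (G i) (K i) (Q i)"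
    and P: "pos_cone C P"
  shows "relatively_ordered_factors amal {1..n} (\<lambda>i. of_factor i ` carrier (G i)) (of_factor k ` K k)
    (\<lambda>i. of_factor i ` Q i) (of_factor k ` \<iota> k ` P)"
proof -
  interpret A: group amal by (rule group_amal)
  interpret C: group C by (rule C_group)
  have Qs: "Q i \<subseteq> carrier (G i)" if "i \<in> {1..n}" for i using Q[OF that] unfolding rel_pos_cone_def by blast
  have Ks: "K i \<subseteq> carrier (G i)" if "i \<in> {1..n}" for i using subgroup.subset[OF K_subgroup[OF that]] .
  have Ps: "P \<subseteq> carrier C" using P unfolding pos_cone_def rel_pos_cone_def by blast
  have inv_Q: "m_inv amal ` of_factor i ` Q i = of_factor i ` m_inv (G i) ` Q i" if i: "i \<in> {1..n}" for i
    unfolding image_image using group_hom.hom_inv[OF of_factor_group_hom[OF i]] Qs[OF i]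
    by (intro image_cong) auto
  have inv_P: "m_inv amal ` of_factor k ` \<iota> k ` P = of_factor k ` \<iota> k ` m_inv C ` P"
  proof -
    have "inv\<^bsub>amal\<^esub> of_factor k (\<iota> k c) = of_factor k (\<iota> k (inv\<^bsub>C\<^esub> c))" if "c \<in> P" for c
    proof -
      have "c \<in> carrier C" using that Ps by blast
      then show ?thesis using iota_closed[OF k]
        by (simp only: group_hom.hom_inv[OF of_factor_group_hom[OF k]] group_hom.hom_inv[OF iota_group_hom[OF k]])
    qed
    then show ?thesis unfolding image_image by (intro image_cong) auto
  qed
  show ?thesis
  proof (intro relatively_ordered_factors.intro relatively_ordered_factors_axioms.intro)
    show "group amal" by (rule group_amal)
    show "finite {1..n}" by simp
    show "subgroup (of_factor i ` carrier (G i)) amal" if "i \<in> {1..n}" for i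
      using group_hom.img_is_subgroup[OF of_factor_group_hom[OF that]] .
    show "subgroup (of_factor k ` K k) amal"
      using group_hom.subgroup_img_is_subgroup[OF of_factor_group_hom[OF k] K_subgroup[OF k]] .
    show "of_factor k ` K k \<subseteq> of_factor i ` carrier (G i)" if "i \<in> {1..n}" for i
      unfolding of_factor_K[OF k that] using Ks[OF that] by (rule image_mono)
    show "x \<otimes>\<^bsub>amal\<^esub> y \<in> of_factor i ` Q i" if i: "i \<in> {1..n}" and xy: "x \<in> of_factor i ` Q i" "y \<in> of_factor i ` Q i" for i x y
    proof -
      obtain g h where gh: "g \<in> Q i" "h \<in> Q i" "x = of_factor i g" "y = of_factor i h" using xy by blast
      then have "x \<otimes>\<^bsub>amal\<^esub> y = of_factor i (g \<otimes>\<^bsub>G i\<^esub> h)"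
        using hom_mult[OF of_factor_hom[OF i]] Qs[OF i] by (simp add: subset_iff)
      moreover have "g \<otimes>\<^bsub>G i\<^esub> h \<in> Q i" using Q[OF i] gh unfolding rel_pos_cone_def by blast
      ultimately show ?thesis by blast
    qed
    show "of_factor i ` carrier (G i) = of_factor i ` Q i \<union> of_factor k ` K k \<union> m_inv amal ` of_factor i ` Q i" if i: "i \<in> {1..n}" for i
    proof -
      have "carrier (G i) = Q i \<union> K i \<union> m_inv (G i) ` Q i" using Q[OF i] unfolding rel_pos_cone_def by blast
      then have "of_factor i ` carrier (G i) = of_factor i ` Q i \<union> of_factor i ` K i \<union> of_factor i ` m_inv (G i) ` Q i"
        by (simp only: image_Un)
      then show ?thesis unfolding inv_Q[OF i] of_factor_K[OF k i] .
    qed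
    show "of_factor i ` Q i \<inter> of_factor k ` K k = {}" if i: "i \<in> {1..n}" for i
    proof -
      have "of_factor i ` Q i \<inter> of_factor i ` K i = of_factor i ` (Q i \<inter> K i)"
        using inj_on_image_Int[OF of_factor_inj_on[OF i] Qs[OF i] Ks[OF i]] by simp
      also have "Q i \<inter> K i = {}" using Q[OF i] unfolding rel_pos_cone_def by blast
      finally show ?thesis unfolding of_factor_K[OF k i] by simp
    qed
    show "of_factor i ` Q i \<inter> m_inv amal ` of_factor i ` Q i = {}" if i: "i \<in> {1..n}" for i
    proof -
      have "m_inv (G i) ` Q i \<subseteq> carrier (G i)"
        using Qs[OF i] group.inv_closed[OF factor_group[OF i]] by blast
      then have "of_factor i ` Q i \<inter> of_factor i ` m_inv (G i) ` Q i = of_factor i ` (Q i \<inter> m_inv (G i) ` Q i)"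
        using inj_on_image_Int[OF of_factor_inj_on[OF i] Qs[OF i]] by simp
      also have "Q i \<inter> m_inv (G i) ` Q i = {}" using Q[OF i] unfolding rel_pos_cone_def by blast
      finally show ?thesis unfolding inv_Q[OF i] by simp
    qed
    show "x \<otimes>\<^bsub>amal\<^esub> y \<in> of_factor k ` \<iota> k ` P" if xy: "x \<in> of_factor k ` \<iota> k ` P" "y \<in> of_factor k ` \<iota> k ` P" for x y
    proof -
      obtain c d where cd: "c \<in> P" "d \<in> P" "x = of_factor k (\<iota> k c)" "y = of_factor k (\<iota> k d)" using xy by blast
      then have "x \<otimes>\<^bsub>amal\<^esub> y = of_factor k (\<iota> k (c \<otimes>\<^bsub>C\<^esub> d))"
        using hom_mult[OF of_factor_hom[OF k]] iota_mult[OF k] iota_closed[OF k] Ps by (simp add: subset_iff)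
      moreover have "c \<otimes>\<^bsub>C\<^esub> d \<in> P" using P cd unfolding pos_cone_def rel_pos_cone_def by blast
      ultimately show ?thesis by blast
    qed
    show "of_factor k ` K k = of_factor k ` \<iota> k ` P \<union> {\<one>\<^bsub>amal\<^esub>} \<union> m_inv amal ` of_factor k ` \<iota> k ` P"
    proof -
      have "carrier C = P \<union> {\<one>\<^bsub>C\<^esub>} \<union> m_inv C ` P" using P unfolding pos_cone_def rel_pos_cone_def by blast
      then have "of_factor k ` \<iota> k ` carrier C = of_factor k ` \<iota> k ` P \<union> {of_factor k (\<iota> k \<one>\<^bsub>C\<^esub>)} \<union> of_factor k ` \<iota> k ` m_inv C ` P"
        by (simp only: image_Un image_empty image_insert)
      then show ?thesis
        unfolding inv_P K_def
        using group_hom.hom_one[OF of_factor_group_hom[OF k]] group_hom.hom_one[OF iota_group_hom[OF k]] by simp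
    qed
    show "\<one>\<^bsub>amal\<^esub> \<notin> of_factor k ` \<iota> k ` P"
    proof
      assume "\<one>\<^bsub>amal\<^esub> \<in> of_factor k ` \<iota> k ` P"
      then obtain c where c: "c \<in> P" "of_factor k (\<iota> k c) = \<one>\<^bsub>amal\<^esub>" by force
      then have "c = \<one>\<^bsub>C\<^esub>" using of_factor_iota_eq_one[OF k] Ps by blast
      then show False using P c(1) unfolding pos_cone_def rel_pos_cone_def by blast
    qed
    show "carrier amal = generate amal (\<Union>i\<in>{1..n}. of_factor i ` carrier (G i))" by (rule amal_generated)
    show "g \<noteq> \<one>\<^bsub>amal\<^esub>"
      if "alternating amal {1..n} (\<lambda>i. of_factor i ` carrier (G i)) (of_factor k ` K k) (\<lambda>i. of_factor i ` Q i) g t a b" for g t a b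
      using alternating_neq_one[OF that] of_factor_K[OF k] by blast
  qed
qed

text \<open>Without factors there are no letters and the amalgam is trivial, so \<open>C\<close> has
  no factor through which to enter. With the trivial subgroup and the empty cone in its place, the
  resulting order is the usual one of the integers.\<close>

lemma amal_ordered_factors_trivial:
  assumes "n = 0"
  shows "relatively_ordered_factors amal {} F {\<one>\<^bsub>amal\<^esub>} Q {}"
proof (intro relatively_ordered_factors.intro relatively_ordered_factors_axioms.intro)
  interpret A: group amal by (rule group_amal)
  show "group amal" by (rule group_amal)
  show "subgroup {\<one>\<^bsub>amal\<^esub>} amal" by (rule A.triv_subgroup)
  show "carrier amal = generate amal (\<Union>i\<in>{}. F i)" using amal_generated assms by simp
  show "g \<noteq> \<one>\<^bsub>amal\<^esub>" if "alternating amal {} F {\<one>\<^bsub>amal\<^esub>} Q g t a b" for g t a b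
    using that by cases auto
qed auto

end

theorem theorem5p14:
  fixes n :: nat
    and G :: "nat \<Rightarrow> 'a monoid"
    and C :: "'c monoid"
    and \<iota> :: "nat \<Rightarrow> 'c \<Rightarrow> 'a"
  assumes fg: "\<And>i. i \<in> {1..n} \<Longrightarrow> fin_gen_group (G i)"
    and C_group: "group C"
    and emb: "\<And>i. i \<in> {1..n} \<Longrightarrow> \<iota> i \<in> hom C (G i) \<and> inj_on (\<iota> i) (carrier C)"
    and cones: "\<And>i. i \<in> {1..n} \<Longrightarrow>
                  \<exists>P. regular_rel_pos_cone (G i) (\<iota> i ` carrier C) P"
    and C_cone: "\<exists>P. regular_pos_cone C P"
  shows "\<exists>R. regular_left_order (amalgamated_product n G C \<iota> \<times>\<times> integer_group) R"
proof -
  interpret amalgam n G C \<iota>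
    by (intro amalgam.intro) (use fg C_group emb in \<open>auto simp: fin_gen_group_def\<close>)
  interpret A: group amal by (rule group_amal)
  show ?thesis
  proof (cases "n = 0")
    case True
    \<comment> \<open>The empty graph shows that the empty set, which is the cone of the trivial
      subgroup, is rational.\<close>
    have "rational amal (walks amal ({} :: (nat \<times> _ \<times> nat) set) {} {})" by (rule rational_walks) auto
    then have "rational amal {}" by (simp add: walks_def)
    then show ?thesis
      using relatively_ordered_factors.regular_left_order_exists[OF amal_ordered_factors_trivial[OF True]] by simp
  next
    case False
    then have k: "1 \<in> {1..n}" by simp
    obtain Q where Q: "\<And>i. i \<in> {1..n} \<Longrightarrow> regular_rel_pos_cone (G i) (K i) (Q i)"
      using cones unfolding K_def by metis
    obtain P where P: "regular_pos_cone C P" using C_cone by blast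
    have "relatively_ordered_factors amal {1..n} (\<lambda>i. of_factor i ` carrier (G i)) (of_factor 1 ` K 1)
        (\<lambda>i. of_factor i ` Q i) (of_factor 1 ` \<iota> 1 ` P)"
      using Q P by (intro amal_ordered_factors[OF k]) (auto simp: regular_rel_pos_cone_def regular_pos_cone_def)
    then show ?thesis
    proof (rule relatively_ordered_factors.regular_left_order_exists)
      fix i assume i: "i \<in> {1..n}"
      have mon: "monoid (G i)" using factor_group[OF i] by (rule group.is_monoid)
      have reg: "regular_set (G i) (Q i)" using Q[OF i] by (simp add: regular_rel_pos_cone_def)
      show "rational amal (of_factor i ` carrier (G i))" "rational amal (of_factor i ` Q i)"
        using regular_set_imp_rational[OF mon reg] group_hom.hom_one[OF of_factor_group_hom[OF i]]
        by (auto intro: rational_image[OF of_factor_hom[OF i] _ mon])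
    next
      have "rational C P"
        using regular_set_imp_rational(1)[OF group.is_monoid[OF C_group]] P by (simp add: regular_pos_cone_def)
      then have "rational (G 1) (\<iota> 1 ` P)"
        using rational_image[OF iota_hom[OF k] group_hom.hom_one[OF iota_group_hom[OF k]] group.is_monoid[OF C_group]]
        by blast
      then show "rational amal (of_factor 1 ` \<iota> 1 ` P)"
        using rational_image[OF of_factor_hom[OF k] group_hom.hom_one[OF of_factor_group_hom[OF k]]
            group.is_monoid[OF factor_group[OF k]]] by blast
    qed
  qed
qed

end
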